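(* Let $A_{-1}\in\mathbb{R}^{n\times n}$ and let $A_2,A_3$ be $n\times n$ matrix functions with entries in $L_2(-1,0)$. Let $\mathcal{A}^*$ be the operator in $M_2=\mathbb{R}^n\times L_2(-1,0;\mathbb{R}^n)$ given by $$\mathcal{A}^{*}\begin{pmatrix} w\\ \psi(\cdot)\end{pmatrix}=\begin{pmatrix} A_2^{*}(0)w+\psi(0)\\ -\dfrac{\mathrm{d}[\psi(\theta)+A_2^{*}(\theta)w]}{\mathrm{d}\theta}+A_3^{*}(\theta)w\end{pmatrix}$$ on the domain $$D(\mathcal{A}^* )=\left\{(w,\psi(\cdot))\in M_2:\ \psi(\theta)+A_2^*(\theta)w\in H^1([-1,0];\mathbb{R}^n),\ A_{-1}^*\big(A_2^*(0)w+\psi(0)\big)=\psi(-1)+A_2^*(-1)w\right\}.$$ Let $x(t)=\begin{pmatrix} w(t)\\ \psi_t(\cdot)\end{pmatrix}$, $t\ge 0$, be a solution of the abstract equation $\dot x=\mathcal{A}^*x$ in $M_2$. Then the function $w(t)$ is the solution of the neutral type equation $$\dot w(t+1)=A_{-1}^*\dot w(t)+\int_{-1}^0\left[A_2^*(\tau)\dot w(t+1+\tau)+A_3^*(\tau)w(t+1+\tau)\right]\mathrm{d}\tau,\qquad t\ge 0 .$$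
   Context: The star on a matrix denotes the transpose. The operator $\mathcal{A}^*$ is the Hilbert space adjoint in $M_2$ of the generator $\mathcal{A}$ of the $C_0$-semigroup associated with the neutral type equation $\dot z(t)=A_{-1}\dot z(t-1)+\int_{-1}^0[A_2(\theta)\dot z(t+\theta)+A_3(\theta)z(t+\theta)]\,\mathrm{d}\theta$, namely $\mathcal{A}(v,\varphi)=\big(\int_{-1}^0[A_2\varphi'+A_3\varphi]\,\mathrm{d}\theta,\ \varphi'\big)$ with $D(\mathcal{A})=\{(v,\varphi): \varphi\in H^1([-1,0];\mathbb{R}^n),\ v=\varphi(0)-A_{-1}\varphi(-1)\}$. Thus $\mathcal{A}^*$ generates a $C_0$-semigroup on $M_2$. Convention: for $(w,\psi)$ with $r:=\psi+A_2^*w\in H^1$, the expressions $A_2^*(0)w+\psi(0)$ and $\psi(-1)+A_2^*(-1)w$ mean $r(0)$ and $r(-1)$, the values of the continuous representative of $r$. A solution of $\dot x=\mathcal{A}^*x$ is a function $x\in C^1([0,\infty);M_2)$ with $x(t)\in D(\mathcal{A}^* )$ for all $t\ge0$ satisfying the equation. *)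

theory Defs
  imports "HOL-Analysis.Analysis"
begin

abbreviation lebI :: "real measure"
  where "lebI \<equiv> lebesgue_on {-1..0}"

definition square_integrable :: "(real \<Rightarrow> 'a::euclidean_space) \<Rightarrow> bool" where
  "square_integrable f \<longleftrightarrow>
     f \<in> borel_measurable lebI \<and> integrable lebI (\<lambda>\<theta>. (norm (f \<theta>))\<^sup>2)"

lemma square_integrable_inner:
  assumes "square_integrable f" "square_integrable g"
  shows "integrable lebI (\<lambda>\<theta>. f \<theta> \<bullet> g \<theta>)"
proof (rule Bochner_Integration.integrable_bound)
  show "integrable lebI (\<lambda>\<theta>. (norm (f \<theta>))\<^sup>2 + (norm (g \<theta>))\<^sup>2)"
    using assms by (auto simp: square_integrable_def)
  show "(\<lambda>\<theta>. f \<theta> \<bullet> g \<theta>) \<in> borel_measurable lebI"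
    using assms by (auto simp: square_integrable_def)
  have "norm (a \<bullet> b) \<le> norm ((norm a)\<^sup>2 + (norm b)\<^sup>2)" for a b :: 'a
  proof -
    have "2 * norm a * norm b \<le> (norm a)\<^sup>2 + (norm b)\<^sup>2"
      by (rule sum_squares_bound)
    moreover have "0 \<le> norm a * norm b" by simp
    ultimately show ?thesis
      using Cauchy_Schwarz_ineq2[of a b] by (simp del: mult_nonneg_nonneg)
  qed
  then show "AE \<theta> in lebI. norm (f \<theta> \<bullet> g \<theta>) \<le> norm ((norm (f \<theta>))\<^sup>2 + (norm (g \<theta>))\<^sup>2)"
    by simp
qed

lemma square_integrable_0: "square_integrable (\<lambda>_. 0)"
  by (simp add: square_integrable_def)

lemma square_integrable_add:
  assumes "square_integrable f" "square_integrable g"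
  shows "square_integrable (\<lambda>\<theta>. f \<theta> + g \<theta>)"
proof -
  have "(norm (f \<theta> + g \<theta>))\<^sup>2 = (norm (f \<theta>))\<^sup>2 + (norm (g \<theta>))\<^sup>2 + 2 * (f \<theta> \<bullet> g \<theta>)" for \<theta>
    by (simp add: power2_norm_eq_inner inner_add inner_commute)
  then show ?thesis
    using assms square_integrable_inner[OF assms] by (auto simp: square_integrable_def)
qed

lemma square_integrable_scaleR:
  assumes "square_integrable f"
  shows "square_integrable (\<lambda>\<theta>. c *\<^sub>R f \<theta>)"
  using assms by (auto simp: square_integrable_def power_mult_distrib)

definition L2_eq :: "(real \<Rightarrow> 'a::euclidean_space) \<Rightarrow> (real \<Rightarrow> 'a) \<Rightarrow> bool" where
  "L2_eq f g \<longleftrightarrow> square_integrable f \<and> square_integrable g \<and> (AE \<theta> in lebI. f \<theta> = g \<theta>)"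

quotient_type (overloaded) 'a L2 = "real \<Rightarrow> 'a::euclidean_space" / partial: L2_eq
proof (rule part_equivpI)
  show "\<exists>f::real \<Rightarrow> 'a. L2_eq f f"
    using square_integrable_0 by (auto simp: L2_eq_def)
  show "symp (L2_eq :: (real \<Rightarrow> 'a) \<Rightarrow> _)"
    by (auto simp: symp_def L2_eq_def elim: AE_mp)
  show "transp (L2_eq :: (real \<Rightarrow> 'a) \<Rightarrow> _)"
    unfolding transp_def L2_eq_def
  proof (intro allI impI conjI; (elim conjE)?)
    fix f g h :: "real \<Rightarrow> 'a"
    assume "AE \<theta> in lebI. f \<theta> = g \<theta>" "AE \<theta> in lebI. g \<theta> = h \<theta>"
    then show "AE \<theta> in lebI. f \<theta> = h \<theta>" by eventually_elim simp
  qed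
qed

instantiation L2 :: (euclidean_space) real_inner
begin

lift_definition zero_L2 :: "'a L2" is "\<lambda>_. 0"
  by (simp add: L2_eq_def square_integrable_0)

lift_definition plus_L2 :: "'a L2 \<Rightarrow> 'a L2 \<Rightarrow> 'a L2" is "\<lambda>f g \<theta>. f \<theta> + g \<theta>"
  unfolding L2_eq_def by (auto intro: square_integrable_add)

lift_definition scaleR_L2 :: "real \<Rightarrow> 'a L2 \<Rightarrow> 'a L2" is "\<lambda>c f \<theta>. c *\<^sub>R f \<theta>"
  unfolding L2_eq_def by (auto intro: square_integrable_scaleR)

definition uminus_L2 :: "'a L2 \<Rightarrow> 'a L2" where "uminus_L2 u = (-1) *\<^sub>R u"

definition minus_L2 :: "'a L2 \<Rightarrow> 'a L2 \<Rightarrow> 'a L2" where "minus_L2 u v = u + (-1) *\<^sub>R v"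

lift_definition inner_L2 :: "'a L2 \<Rightarrow> 'a L2 \<Rightarrow> real" is
  "\<lambda>f g. \<integral>\<theta>. f \<theta> \<bullet> g \<theta> \<partial>lebI"
  unfolding L2_eq_def
  by (intro integral_cong_AE) (auto simp: square_integrable_def)

definition norm_L2 :: "'a L2 \<Rightarrow> real" where "norm_L2 u = sqrt (u \<bullet> u)"

definition sgn_L2 :: "'a L2 \<Rightarrow> 'a L2" where "sgn_L2 u = inverse (norm u) *\<^sub>R u"

definition dist_L2 :: "'a L2 \<Rightarrow> 'a L2 \<Rightarrow> real" where "dist_L2 u v = norm (u - v)"

definition uniformity_L2 :: "('a L2 \<times> 'a L2) filter" where
  "uniformity_L2 = (INF e\<in>{0 <..}. principal {(x, y). dist x y < e})"

definition open_L2 :: "'a L2 set \<Rightarrow> bool" where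
  "open_L2 U \<longleftrightarrow> (\<forall>x\<in>U. eventually (\<lambda>(x', y). x' = x \<longrightarrow> y \<in> U) uniformity)"

instance
proof
  fix u v z :: "'a L2" and a b :: real
  show "u + v + z = u + (v + z)"
    by transfer (auto simp: L2_eq_def add.assoc intro!: square_integrable_add)
  show "u + v = v + u"
    by transfer (auto simp: L2_eq_def add.commute intro!: square_integrable_add)
  show "0 + u = u"
    by transfer (auto simp: L2_eq_def)
  show "- u + u = 0"
    unfolding uminus_L2_def
    by transfer (auto simp: L2_eq_def square_integrable_0 intro!: square_integrable_add square_integrable_scaleR)
  show "u - v = u + - v"
    by (simp add: uminus_L2_def minus_L2_def)
  show "a *\<^sub>R (u + v) = a *\<^sub>R u + a *\<^sub>R v"
    by transfer (auto simp: L2_eq_def scaleR_add_right intro!: square_integrable_add square_integrable_scaleR)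
  show "(a + b) *\<^sub>R u = a *\<^sub>R u + b *\<^sub>R u"
    by transfer (auto simp: L2_eq_def scaleR_add_left intro!: square_integrable_add square_integrable_scaleR)
  show "a *\<^sub>R b *\<^sub>R u = (a * b) *\<^sub>R u"
    by transfer (auto simp: L2_eq_def intro!: square_integrable_scaleR)
  show "1 *\<^sub>R u = u"
    by transfer (auto simp: L2_eq_def)
  show "dist u v = norm (u - v)"
    by (rule dist_L2_def)
  show "sgn u = inverse (norm u) *\<^sub>R u"
    by (rule sgn_L2_def)
  show "uniformity = (INF e\<in>{0 <..}. principal {(x::'a L2, y). dist x y < e})"
    by (rule uniformity_L2_def)
  show "open U \<longleftrightarrow> (\<forall>x\<in>U. eventually (\<lambda>(x', y). x' = x \<longrightarrow> y \<in> U) uniformity)" for U :: "'a L2 set"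
    by (rule open_L2_def)
  show "u \<bullet> v = v \<bullet> u"
    by transfer (simp add: inner_commute)
  show "(u + v) \<bullet> z = u \<bullet> z + v \<bullet> z"
    by transfer (auto simp: L2_eq_def inner_add_left intro!: Bochner_Integration.integral_add square_integrable_inner)
  show "a *\<^sub>R u \<bullet> v = a * (u \<bullet> v)"
    by transfer simp
  show "0 \<le> u \<bullet> u"
    by transfer (simp add: integral_nonneg_AE)
  show "u \<bullet> u = 0 \<longleftrightarrow> u = 0"
  proof transfer
    fix f :: "real \<Rightarrow> 'a" assume "L2_eq f f"
    then have f: "square_integrable f" by (simp add: L2_eq_def)
    show "(\<integral>\<theta>. f \<theta> \<bullet> f \<theta> \<partial>lebI) = 0 \<longleftrightarrow> L2_eq f (\<lambda>_. 0)"
      using integral_nonneg_eq_0_iff_AE[OF square_integrable_inner[OF f f]] f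
      by (simp add: L2_eq_def square_integrable_0)
  qed
  show "norm u = sqrt (u \<bullet> u)"
    by (rule norm_L2_def)
qed

end

text \<open>
  The class of a function in \<open>L\<^sub>2(-1,0)\<close>; meaningful only for square integrable functions.
\<close>

definition to_L2 :: "(real \<Rightarrow> 'a::euclidean_space) \<Rightarrow> 'a L2" where
  "to_L2 f = abs_L2 f"

text \<open>
  Test functions are the continuously differentiable functions with compact support in the open
  interval \<open>(-1,0)\<close>. By mollification they yield the same weak derivatives as smooth ones.
\<close>

definition test_function :: "(real \<Rightarrow> real) \<Rightarrow> bool" where
  "test_function \<phi> \<longleftrightarrow>
     \<phi> C1_differentiable_on UNIV \<and> closure {\<theta>. \<phi> \<theta> \<noteq> 0} \<subseteq> {-1<..<0}"

text \<open>
  The function \<open>rep_L2 u\<close> is some representative of \<open>u\<close>; the integrals do not depend on which one.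
\<close>

definition has_weak_derivative :: "'a::euclidean_space L2 \<Rightarrow> 'a L2 \<Rightarrow> bool"
    (infix "has'_weak'_derivative" 50) where
  "u has_weak_derivative g \<longleftrightarrow>
     (\<forall>\<phi>. test_function \<phi> \<longrightarrow>
        (\<integral>\<theta>. deriv \<phi> \<theta> *\<^sub>R rep_L2 u \<theta> \<partial>lebI) = - (\<integral>\<theta>. \<phi> \<theta> *\<^sub>R rep_L2 g \<theta> \<partial>lebI))"

definition H1 :: "'a::euclidean_space L2 set" where
  "H1 = {u. \<exists>g. u has_weak_derivative g}"

definition weak_deriv :: "'a::euclidean_space L2 \<Rightarrow> 'a L2" where
  "weak_deriv u = (THE g. u has_weak_derivative g)"

text \<open>
  The value at \<open>\<theta> \<in> [-1,0]\<close> of the continuous representative of \<open>u\<close>, for \<open>u \<in> H1\<close>.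
\<close>

definition L2_at :: "'a::euclidean_space L2 \<Rightarrow> real \<Rightarrow> 'a" where
  "L2_at u \<theta> = (THE v. \<exists>c. continuous_on {-1..0} c \<and> to_L2 c = u \<and> c \<theta> = v)"

text \<open>
  The space \<open>M\<^sub>2\<close> carries the Hilbert space structure of the product.
\<close>

type_synonym 'n M2 = "(real^'n) \<times> (real^'n) L2"

definition L2_matrix :: "(real \<Rightarrow> real^'n^'n) \<Rightarrow> bool" where
  "L2_matrix A \<longleftrightarrow> (\<forall>i j. square_integrable (\<lambda>\<theta>. A \<theta> $ i $ j))"

definition transpose_mult :: "(real \<Rightarrow> real^'n^'n) \<Rightarrow> real^'n \<Rightarrow> (real^'n) L2" where
  "transpose_mult A w = to_L2 (\<lambda>\<theta>. transpose (A \<theta>) *v w)"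

definition adjoint_domain :: "real^'n^'n \<Rightarrow> (real \<Rightarrow> real^'n^'n) \<Rightarrow> 'n M2 set" where
  "adjoint_domain Am1 A2 =
     {(w, \<psi>). let r = \<psi> + transpose_mult A2 w
              in r \<in> H1 \<and> transpose Am1 *v L2_at r 0 = L2_at r (-1)}"

definition adjoint_op ::
    "(real \<Rightarrow> real^'n^'n) \<Rightarrow> (real \<Rightarrow> real^'n^'n) \<Rightarrow> 'n M2 \<Rightarrow> 'n M2" where
  "adjoint_op A2 A3 = (\<lambda>(w, \<psi>).
     let r = \<psi> + transpose_mult A2 w
     in (L2_at r 0, - weak_deriv r + transpose_mult A3 w))"

text \<open>
  A solution in \<open>C\<^sup>1([0,\<infinity>))\<close> of \<open>\<dot>x = T x\<close> for an operator \<open>T\<close> with domain \<open>D\<close>; the derivative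
  at \<open>0\<close> is one-sided.
\<close>

definition abstract_solution ::
    "'a::real_normed_vector set \<Rightarrow> ('a \<Rightarrow> 'a) \<Rightarrow> (real \<Rightarrow> 'a) \<Rightarrow> bool" where
  "abstract_solution D T x \<longleftrightarrow>
     (\<exists>x'. continuous_on {0..} x' \<and>
        (\<forall>t\<ge>0. (x has_vector_derivative x' t) (at t within {0..}) \<and> x t \<in> D \<and> x' t = T (x t)))"

text \<open>
  The integral defaults to \<open>0\<close> for a non-integrable function, so integrability is part of
  the notion of solution.
\<close>

definition neutral_solution ::
    "real^'n^'n \<Rightarrow> (real \<Rightarrow> real^'n^'n) \<Rightarrow> (real \<Rightarrow> real^'n^'n) \<Rightarrow> (real \<Rightarrow> real^'n) \<Rightarrow> bool" where
  "neutral_solution Am1 A2 A3 w \<longleftrightarrow>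
     (\<exists>w'. continuous_on {0..} w' \<and>
        (\<forall>t\<ge>0. (w has_vector_derivative w' t) (at t within {0..})) \<and>
        (\<forall>t\<ge>0.
           integrable lebI (\<lambda>\<tau>. transpose (A2 \<tau>) *v w' (t + 1 + \<tau>) + transpose (A3 \<tau>) *v w (t + 1 + \<tau>)) \<and>
           w' (t + 1) = transpose Am1 *v w' t +
             (\<integral>\<tau>. (transpose (A2 \<tau>) *v w' (t + 1 + \<tau>) + transpose (A3 \<tau>) *v w (t + 1 + \<tau>)) \<partial>lebI)))"

end

theory Submission
  imports Defs
begin

text \<open>
  Put \<open>r t = \<psi>\<^sub>t + A\<^sub>2\<^sup>* w t\<close>. The abstract equation says that \<open>r\<close> solves the transport equation
  \<open>\<partial>\<^sub>t r = - \<partial>\<^sub>\<theta> r + A\<^sub>3\<^sup>* w + A\<^sub>2\<^sup>* w'\<close> with the boundary values \<open>w' t\<close> at \<open>0\<close> and \<open>A\<^sub>-\<^sub>1\<^sup>* w' t\<close> at \<open>-1\<close>;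
  formally, integrating along the characteristic that joins \<open>(t, -1)\<close> to \<open>(t + 1, 0)\<close> gives the neutral
  equation. Since \<open>r t\<close> is only differentiable in \<open>t\<close> as an \<open>L\<^sub>2\<close> function, the tail integrals
  \<open>P(s, a) = \<integral>\<^sub>a\<^sup>0 r s\<close>, tested against a vector, are differentiated along the characteristic instead.
  Integrating the result expresses \<open>P(t, -1)\<close> through \<open>w\<close> alone, and the derivative of
  this identity with respect to \<open>t\<close> is the neutral equation.
\<close>

section \<open>Integrals over the delay interval\<close>

lemma integrable_lebI_continuous_scaleR:
  fixes h :: "real \<Rightarrow> 'a::euclidean_space"
  assumes "continuous_on {-1..0} \<eta>" "integrable lebI h"
  shows "integrable lebI (\<lambda>x. \<eta> x *\<^sub>R h x)"
proof -
  obtain K where K: "\<And>a. a \<in> {-1..0} \<Longrightarrow> norm (\<eta> a) \<le> K"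
    using compact_imp_bounded[OF compact_continuous_image[OF assms(1) compact_Icc]] by (fastforce simp: bounded_iff)
  have [measurable]: "\<eta> \<in> borel_measurable lebI"
    using continuous_imp_measurable_on_sets_lebesgue[OF assms(1)] by simp
  have [measurable]: "h \<in> borel_measurable lebI" using assms(2) by simp
  show ?thesis
  proof (rule Bochner_Integration.integrable_bound)
    show "integrable lebI (\<lambda>x. K *\<^sub>R h x)" using assms(2) by simp
    show "AE x in lebI. norm (\<eta> x *\<^sub>R h x) \<le> norm (K *\<^sub>R h x)"
      using K by (intro AE_I2) (force simp: intro!: mult_right_mono)
  qed measurable
qed

lemma integrable_lebI_continuous_inner:
  fixes f g :: "real \<Rightarrow> 'a::euclidean_space"
  assumes "continuous_on {-1..0} f" "integrable lebI g"
  shows "integrable lebI (\<lambda>x. f x \<bullet> g x)"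
proof -
  have "integrable lebI (\<lambda>x. (f x \<bullet> b) *\<^sub>R (g x \<bullet> b))" for b
    by (intro integrable_lebI_continuous_scaleR continuous_intros assms integrable_inner_left)
  then have "integrable lebI (\<lambda>x. \<Sum>b\<in>Basis. (f x \<bullet> b) * (g x \<bullet> b))"
    by (intro Bochner_Integration.integrable_sum) simp
  moreover have "(\<Sum>b\<in>Basis. (f x \<bullet> b) * (g x \<bullet> b)) = f x \<bullet> g x" for x
    by (rule euclidean_inner[symmetric])
  ultimately show ?thesis by (simp only:)
qed

lemma integrable_componentwise_lebI:
  fixes f :: "real \<Rightarrow> 'a::euclidean_space"
  assumes "\<And>v. integrable lebI (\<lambda>x. f x \<bullet> v)"
  shows "integrable lebI f"
proof -
  have "integrable lebI (\<lambda>x. \<Sum>b\<in>Basis. (f x \<bullet> b) *\<^sub>R b)"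
    by (intro Bochner_Integration.integrable_sum integrable_scaleR_left assms)
  then show ?thesis by (simp add: euclidean_representation)
qed

text \<open>Write \<open>f \<tau>\<close> as \<open>f (-1)\<close> plus the integral of
  \<open>f'\<close> over \<open>{-1..\<tau>}\<close>; exchanging the order of integration over a
  triangle collects \<open>g\<close> into tail integrals. All regularity is put on \<open>f\<close>,
  so \<open>g\<close> may be merely integrable.\<close>

lemma integration_by_parts_tail:
  fixes f :: "real \<Rightarrow> 'a::euclidean_space"
  assumes f: "\<And>a. a \<in> {-1..0} \<Longrightarrow> (f has_vector_derivative f' a) (at a within {-1..0})"
    and f': "continuous_on {-1..0} f'"
    and g: "integrable lebI g"
  shows "(\<integral>\<tau>. f \<tau> \<bullet> g \<tau> \<partial>lebI) =
    f (-1) \<bullet> integral {-1..0} g + integral {-1..0} (\<lambda>a. f' a \<bullet> integral {a..0} g)"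
proof -
  interpret finite_measure lebI by (rule finite_measure_lebesgue_on) simp
  interpret L: sigma_finite_measure lebI by unfold_locales
  interpret pair_sigma_finite lebI lebI ..
  have gm[measurable]: "g \<in> borel_measurable lebI" using g by simp
  have f'm[measurable]: "f' \<in> borel_measurable lebI"
    using continuous_imp_measurable_on_sets_lebesgue[OF f'] by simp
  \<comment> \<open>Measurability of the identity with respect to \<open>lebI\<close> makes the
    triangle \<open>a \<le> \<tau>\<close> measurable in the product measure.\<close>
  have idm[measurable]: "(\<lambda>x. x) \<in> borel_measurable lebI"
    using continuous_imp_measurable_on_sets_lebesgue[of "{-1..0}" "\<lambda>x::real. x"] by simp
  have cf: "continuous_on {-1..0} f"
    using f has_vector_derivative_continuous by (force simp: continuous_on_eq_continuous_within)
  \<comment> \<open>The integrand on the triangle, extended by 0; \<open>inner1\<close> and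
    \<open>inner2\<close> compute the inner integrals of its two iterated integrals.\<close>
  define H where "H \<tau> a = (if a \<le> \<tau> then f' a \<bullet> g \<tau> else 0)" for \<tau> a
  obtain K where K: "\<And>a. a \<in> {-1..0} \<Longrightarrow> norm (f' a) \<le> K"
    using compact_imp_bounded[OF compact_continuous_image[OF f' compact_Icc]] by (fastforce simp: bounded_iff)
  have Hm[measurable]: "case_prod H \<in> borel_measurable (lebI \<Otimes>\<^sub>M lebI)"
    unfolding H_def case_prod_beta by measurable
  have Hi: "integrable (lebI \<Otimes>\<^sub>M lebI) (case_prod H)"
  proof (rule Bochner_Integration.integrable_bound)
    show "integrable (lebI \<Otimes>\<^sub>M lebI) (\<lambda>(\<tau>, a). norm (g \<tau>) * K)"
      using g by (intro Fubini_integrable) (auto simp: case_prod_beta abs_mult)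
    show "AE x in lebI \<Otimes>\<^sub>M lebI. norm (case_prod H x) \<le> norm (case x of (\<tau>, a) \<Rightarrow> norm (g \<tau>) * K)"
    proof (rule AE_I2, clarify)
      fix \<tau> a assume "(\<tau>, a) \<in> space (lebI \<Otimes>\<^sub>M lebI)"
      then have a: "a \<in> {-1..0}" by (auto simp: space_pair_measure)
      have "\<bar>f' a \<bullet> g \<tau>\<bar> \<le> norm (f' a) * norm (g \<tau>)" by (rule Cauchy_Schwarz_ineq2)
      also have "\<dots> \<le> \<bar>norm (g \<tau>) * K\<bar>"
        using order.trans[OF K[OF a] abs_ge_self] by (simp add: abs_mult mult.commute[of "norm (g \<tau>)"] mult_right_mono)
      finally show "norm (H \<tau> a) \<le> norm (norm (g \<tau>) * K)"
        by (auto simp: H_def)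
    qed
  qed measurable
  have inner1: "(\<integral>a. H \<tau> a \<partial>lebI) = f \<tau> \<bullet> g \<tau> - f (-1) \<bullet> g \<tau>" if "\<tau> \<in> {-1..0}" for \<tau>
  proof -
    have "(\<integral>a. H \<tau> a \<partial>lebI) = (\<integral>a. (if a \<in> {-1..\<tau>} then f' a \<bullet> g \<tau> else 0) \<partial>lebI)"
      by (intro Bochner_Integration.integral_cong) (auto simp: H_def)
    also have "\<dots> = (\<integral>a. f' a \<bullet> g \<tau> \<partial>lebesgue_on {-1..\<tau>})"
      using that by (intro integral_restrict) auto
    also have "\<dots> = integral {-1..\<tau>} (\<lambda>a. f' a \<bullet> g \<tau>)"
      using that by (intro lebesgue_integral_eq_integral continuous_imp_integrable_real)
        (auto intro!: continuous_intros continuous_on_subset[OF f'])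
    also have "\<dots> = f \<tau> \<bullet> g \<tau> - f (-1) \<bullet> g \<tau>"
    proof (intro integral_unique fundamental_theorem_of_calculus)
      fix x assume "x \<in> {-1..\<tau>}"
      then have "(f has_vector_derivative f' x) (at x within {-1..\<tau>})"
        using f[of x] that by (auto intro: has_vector_derivative_within_subset)
      then show "((\<lambda>\<tau>'. f \<tau>' \<bullet> g \<tau>) has_vector_derivative f' x \<bullet> g \<tau>) (at x within {-1..\<tau>})"
        by (rule bounded_linear.has_vector_derivative[OF bounded_linear_inner_left])
    qed (use that in auto)
    finally show ?thesis .
  qed
  have inner2: "(\<integral>\<tau>. H \<tau> a \<partial>lebI) = f' a \<bullet> integral {a..0} g" if a: "a \<in> {-1..0}" for a
  proof -
    have ga: "integrable (lebesgue_on {a..0}) g"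
      by (rule integrable_subinterval[OF g]) (use a in auto)
    have "(\<integral>\<tau>. H \<tau> a \<partial>lebI) = (\<integral>\<tau>. (if \<tau> \<in> {a..0} then f' a \<bullet> g \<tau> else 0) \<partial>lebI)"
      by (intro Bochner_Integration.integral_cong) (auto simp: H_def)
    also have "\<dots> = (\<integral>\<tau>. f' a \<bullet> g \<tau> \<partial>lebesgue_on {a..0})"
      using a by (intro integral_restrict) auto
    also have "\<dots> = f' a \<bullet> integral {a..0} g"
      using ga by (simp add: lebesgue_integral_eq_integral)
    finally show ?thesis .
  qed
  have fi: "integrable lebI (\<lambda>\<tau>. f \<tau> \<bullet> g \<tau>)"
    by (rule integrable_lebI_continuous_inner[OF cf g])
  have cG: "continuous_on {-1..0} (\<lambda>a. integral {a..0} g)"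
    using g by (intro indefinite_integral_continuous_1' integrable_on_lebesgue_on) auto
  have "(\<integral>\<tau>. f \<tau> \<bullet> g \<tau> \<partial>lebI) - f (-1) \<bullet> (\<integral>\<tau>. g \<tau> \<partial>lebI) = (\<integral>\<tau>. (f \<tau> \<bullet> g \<tau> - f (-1) \<bullet> g \<tau>) \<partial>lebI)"
    using fi g by simp
  also have "\<dots> = (\<integral>\<tau>. (\<integral>a. H \<tau> a \<partial>lebI) \<partial>lebI)"
    by (intro Bochner_Integration.integral_cong) (auto simp: inner1)
  also have "\<dots> = (\<integral>a. (\<integral>\<tau>. H \<tau> a \<partial>lebI) \<partial>lebI)"
    by (rule Fubini_integral[OF Hi, symmetric])
  also have "\<dots> = (\<integral>a. f' a \<bullet> integral {a..0} g \<partial>lebI)"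
    by (intro Bochner_Integration.integral_cong) (auto simp: inner2)
  also have "\<dots> = integral {-1..0} (\<lambda>a. f' a \<bullet> integral {a..0} g)"
    by (intro lebesgue_integral_eq_integral continuous_imp_integrable_real continuous_intros f' cG) auto
  finally show ?thesis
    using g by (simp add: lebesgue_integral_eq_integral)
qed

text \<open>Pairing with a fixed \<open>v\<close> reduces this to the previous lemma for the vector
  function \<open>f \<tau> *\<^sub>R v\<close>.\<close>

lemma integration_by_parts_tail_scaleR:
  fixes g :: "real \<Rightarrow> 'a::euclidean_space"
  assumes f: "\<And>a. a \<in> {-1..0} \<Longrightarrow> (f has_vector_derivative f' a) (at a within {-1..0})"
    and f': "continuous_on {-1..0} f'"
    and g: "integrable lebI g"
  shows "(\<integral>\<tau>. f \<tau> *\<^sub>R g \<tau> \<partial>lebI) =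
    f (-1) *\<^sub>R integral {-1..0} g + integral {-1..0} (\<lambda>a. f' a *\<^sub>R integral {a..0} g)" (is "?L = ?R")
proof -
  have cf: "continuous_on {-1..0} f"
    using f has_vector_derivative_continuous by (force simp: continuous_on_eq_continuous_within)
  have cG: "continuous_on {-1..0} (\<lambda>a. integral {a..0} g)"
    using g by (intro indefinite_integral_continuous_1' integrable_on_lebesgue_on) auto
  have "?L \<bullet> v = ?R \<bullet> v" for v
  proof -
    have "?L \<bullet> v = (\<integral>\<tau>. (f \<tau> *\<^sub>R g \<tau>) \<bullet> v \<partial>lebI)"
      using integrable_lebI_continuous_scaleR[OF cf g] by (intro integral_inner_left[symmetric])
    also have "\<dots> = (\<integral>\<tau>. (f \<tau> *\<^sub>R v) \<bullet> g \<tau> \<partial>lebI)"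
      by (simp add: inner_commute)
    also have "\<dots> = (f (-1) *\<^sub>R v) \<bullet> integral {-1..0} g + integral {-1..0} (\<lambda>a. (f' a *\<^sub>R v) \<bullet> integral {a..0} g)"
      by (rule integration_by_parts_tail[OF _ _ g])
        (auto intro!: bounded_linear.has_vector_derivative[OF bounded_linear_scaleR_left] continuous_intros f f')
    also have "integral {-1..0} (\<lambda>a. (f' a *\<^sub>R v) \<bullet> integral {a..0} g) = integral {-1..0} ((\<lambda>y. y \<bullet> v) \<circ> (\<lambda>a. f' a *\<^sub>R integral {a..0} g))"
      by (simp add: o_def inner_commute)
    also have "\<dots> = integral {-1..0} (\<lambda>a. f' a *\<^sub>R integral {a..0} g) \<bullet> v"
      by (intro integral_linear integrable_continuous_interval continuous_intros f' cG bounded_linear_inner_left)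
    finally show ?thesis by (simp only: inner_add_left inner_scaleR_left inner_commute[of v])
  qed
  then show ?thesis using vector_eq_rdot[of ?L ?R] by blast
qed

section \<open>The fundamental lemma of the calculus of variations and the du Bois-Reymond
  lemma\<close>

lemma AE_lebI:
  assumes "AE x in lebesgue. P x"
  shows "AE x in lebI. P x"
proof -
  have "AE x in lebesgue. x \<in> {-1..0} \<longrightarrow> P x" using assms by (rule eventually_mono) simp
  then show ?thesis by (subst AE_restrict_space_iff) simp_all
qed

text \<open>Bounded limits of admissible \<open>\<eta>\<close> give the indicators of open subsets
  of the open interval, and limits of these give the indicators of all measurable sets up to null
  sets. So the integral of \<open>h\<close> over every measurable set vanishes.\<close>

lemma AE_zero_if_integrals_zero:
  fixes h :: "real \<Rightarrow> 'a::euclidean_space"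
  assumes h: "integrable lebI h"
    and zero: "\<And>\<eta>. continuous_on UNIV \<eta> \<Longrightarrow> closure {x. \<eta> x \<noteq> 0} \<subseteq> {-1<..<0} \<Longrightarrow> (\<integral>x. \<eta> x *\<^sub>R h x \<partial>lebI) = 0"
  shows "AE x in lebI. h x = 0"
proof -
  have hm[measurable]: "h \<in> borel_measurable lebI" using h by simp
  have nh: "integrable lebI (\<lambda>x. norm (h x))" using h by simp
  have open_zero: "(\<integral>x. indicat_real U x *\<^sub>R h x \<partial>lebI) = 0" if U: "open U" "U \<subseteq> {-1<..<0}" for U
  proof -
    define d where "d x = infdist x (- U)" for x
    \<comment> \<open>For positive \<open>n\<close>, \<open>\<eta> n\<close> is 1 where the distance
      \<open>d\<close> to the complement of \<open>U\<close> is at least \<open>2 / n\<close> and 0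
      where it is at most \<open>1 / n\<close>; this gap keeps the closed support inside
      \<open>U\<close>.\<close>
    define \<eta> where "\<eta> n x = max 0 (min 1 (real n * d x - 1))" for n x
    have cd: "continuous_on UNIV d" unfolding d_def by (intro continuous_intros)
    have ce: "continuous_on UNIV (\<eta> n)" for n
      unfolding \<eta>_def by (intro continuous_intros cd)
    \<comment> \<open>The distance to the empty set is 0 by default, so describing \<open>U\<close>
      by \<open>d\<close> requires a nonempty complement.\<close>
    have ne: "- U \<noteq> {}" using U(2) by (metis Compl_empty_eq UNIV_I double_compl greaterThanLessThan_iff less_irrefl subsetD)
    have d0: "d x = 0 \<longleftrightarrow> x \<notin> U" for x
      using in_closed_iff_infdist_zero[of "- U" x] U(1) ne by (simp add: d_def closed_Compl)
    have dpos: "d x \<ge> 0" for x by (simp add: d_def infdist_nonneg)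
    have supp: "closure {x. \<eta> n x \<noteq> 0} \<subseteq> {-1<..<0}" for n
    proof -
      have "closed {x. real n * d x \<ge> 1}"
        by (intro closed_Collect_le continuous_intros cd)
      moreover have "{x. \<eta> n x \<noteq> 0} \<subseteq> {x. real n * d x \<ge> 1}"
        by (auto simp: \<eta>_def max_def min_def split: if_splits)
      ultimately have "closure {x. \<eta> n x \<noteq> 0} \<subseteq> {x. real n * d x \<ge> 1}"
        by (rule closure_minimal[rotated])
      also have "\<dots> \<subseteq> U" using d0 by force
      finally show ?thesis using U(2) by blast
    qed
    have lim: "(\<lambda>n. \<eta> n x) \<longlonglongrightarrow> indicat_real U x" for x
    proof (cases "x \<in> U")
      case True
      then have "d x > 0" using d0[of x] dpos[of x] by linarith
      then obtain N where N: "2 / d x < real N" using reals_Archimedean2 by blast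
      have "\<eta> n x = 1" if "n \<ge> N" for n
      proof -
        have "2 / d x < real n" using N that by linarith
        then have "real n * d x > 2" using \<open>d x > 0\<close> by (simp add: field_simps)
        then show ?thesis by (simp add: \<eta>_def)
      qed
      then have "eventually (\<lambda>n. \<eta> n x = 1) sequentially" by (auto simp: eventually_sequentially)
      then show ?thesis using True by (simp add: tendsto_eventually)
    next
      case False
      then show ?thesis by (simp add: \<eta>_def d0[THEN iffD2])
    qed
    have em[measurable]: "\<eta> n \<in> borel_measurable lebI" for n
      using continuous_imp_measurable_on_sets_lebesgue[OF continuous_on_subset[OF ce subset_UNIV], of "{-1..0}"] by simp
    have Um[measurable]: "indicat_real U \<in> borel_measurable lebI"
      using U(1) by (intro measurable_restrict_space1 borel_measurable_indicator) auto
    have "(\<lambda>n. \<integral>x. \<eta> n x *\<^sub>R h x \<partial>lebI) \<longlonglongrightarrow> (\<integral>x. indicat_real U x *\<^sub>R h x \<partial>lebI)"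
    proof (rule integral_dominated_convergence[OF _ _ nh])
      show "AE x in lebI. norm (\<eta> n x *\<^sub>R h x) \<le> norm (h x)" for n
        by (intro AE_I2) (auto simp: \<eta>_def intro!: mult_left_le_one_le)
      show "AE x in lebI. (\<lambda>n. \<eta> n x *\<^sub>R h x) \<longlonglongrightarrow> indicat_real U x *\<^sub>R h x"
        by (intro AE_I2 tendsto_intros lim)
    qed (measurable)
    then show ?thesis using zero[OF ce supp] by (simp add: LIMSEQ_const_iff)
  qed
  have Gm: "indicat_real G \<in> borel_measurable lebI" if "G \<in> sets lebesgue" for G
    using that by (intro measurable_restrict_space1 borel_measurable_indicator)
  \<comment> \<open>A measurable set may contain the end points, which the open sets
    \<open>U n\<close> below exclude.\<close>
  have ends: "AE x in lebI. x \<noteq> -1 \<and> x \<noteq> 0"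
  proof -
    have "negligible {-1, 0::real}" by (intro negligible_finite) simp
    then have "AE x in lebesgue. x \<notin> {-1, 0::real}"
      by (intro AE_not_in) (simp add: negligible_iff_null_sets)
    then have "AE x in lebI. x \<notin> {-1, 0}" by (rule AE_lebI)
    then show ?thesis by (rule eventually_mono) simp
  qed
  interpret finite_measure lebI by (rule finite_measure_lebesgue_on) simp
  show ?thesis
  proof (rule density_zero[OF h])
    fix A assume "A \<in> sets lebI"
    then have A: "A \<in> sets lebesgue" "A \<subseteq> {-1..0}" by (auto simp: sets_restrict_space)
    obtain C T where CT: "gdelta C" "T \<in> null_sets lebesgue" "A \<union> T = C" "disjnt A T"
      using lebesgue_set_almost_gdelta[OF A(1)] .
    then obtain F :: "nat \<Rightarrow> real set" where F: "\<And>n. open (F n)" "C = \<Inter>(range F)"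
      by (auto elim!: gdelta.cases)
    \<comment> \<open>\<open>C\<close> differs from \<open>A\<close> by the null set
      \<open>T\<close>. The finite intersections are decreasing open sets, and their indicators
      converge to that of \<open>A\<close> off \<open>T\<close> and the end points.\<close>
    define U where "U n = (\<Inter>i\<le>n. F i) \<inter> {-1<..<0}" for n
    have U: "open (U n)" "U n \<subseteq> {-1<..<0}" for n
      unfolding U_def by (auto intro!: open_Int open_INT F)
    have "(\<lambda>n. \<integral>x. indicat_real (U n) x *\<^sub>R h x \<partial>lebI) \<longlonglongrightarrow> (\<integral>x. indicat_real A x *\<^sub>R h x \<partial>lebI)"
    proof (rule integral_dominated_convergence[OF _ _ nh])
      show "(\<lambda>x. indicat_real (U n) x *\<^sub>R h x) \<in> borel_measurable lebI" for n
        using U(1)[of n] Gm[of "U n"] hm by (auto intro!: borel_measurable_scaleR)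
      show "(\<lambda>x. indicat_real A x *\<^sub>R h x) \<in> borel_measurable lebI"
        using Gm[OF A(1)] hm by (auto intro!: borel_measurable_scaleR)
      show "AE x in lebI. norm (indicat_real (U n) x *\<^sub>R h x) \<le> norm (h x)" for n
        by (intro AE_I2) (auto simp: indicator_def)
      have "AE x in lebesgue. x \<notin> T" using CT(2) by (rule AE_not_in)
      then have "AE x in lebI. x \<notin> T" by (rule AE_lebI)
      with ends show "AE x in lebI. (\<lambda>n. indicat_real (U n) x *\<^sub>R h x) \<longlonglongrightarrow> indicat_real A x *\<^sub>R h x"
      proof eventually_elim
        case (elim x)
        have "(\<lambda>n. indicat_real (U n) x) \<longlonglongrightarrow> indicat_real A x"
        proof (cases "x \<in> A")
          case True
          then have "x \<in> U n" for n using elim A(2) CT(3) F(2) by (force simp: U_def)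
          then show ?thesis using True by simp
        next
          case False
          then obtain N where "x \<notin> F N" using elim CT(3) F(2) by blast
          then have "x \<notin> U n" if "n \<ge> N" for n using that by (auto simp: U_def)
          then have "eventually (\<lambda>n. indicat_real (U n) x = 0) sequentially"
            unfolding eventually_sequentially by (intro exI[of _ N]) (simp add: indicator_def)
          then show ?thesis using False by (simp add: tendsto_eventually)
        qed
        then show ?case by (intro tendsto_intros)
      qed
    qed
    then show "set_lebesgue_integral lebI A h = 0"
      using open_zero[OF U] by (simp add: set_lebesgue_integral_def LIMSEQ_const_iff)
  qed
qed

text \<open>The norm of \<open>c\<close> is continuous with integral zero. Consequently two
  continuous representatives of one class agree everywhere, which makes \<open>L2_at\<close> well
  defined.\<close>

lemma continuous_AE_eq_0:
  fixes c :: "real \<Rightarrow> 'a::euclidean_space"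
  assumes "continuous_on {-1..0} c" "AE x in lebI. c x = 0" "\<theta> \<in> {-1..0}"
  shows "c \<theta> = 0"
proof -
  have cn: "continuous_on {-1..0} (\<lambda>x. norm (c x))" by (intro continuous_intros assms)
  have "integral {-1..0} (\<lambda>x. norm (c x)) = (\<integral>x. norm (c x) \<partial>lebI)"
    using cn by (intro lebesgue_integral_eq_integral[symmetric] continuous_imp_integrable_real) auto
  also have "\<dots> = 0"
    using assms(2) by (intro integral_eq_zero_AE) auto
  finally have "\<forall>x\<in>{-1..0}. norm (c x) = 0"
    using integral_eq_0_iff[OF cn] by auto
  then show ?thesis using assms(3) by simp
qed

text \<open>The candidate is the primitive from -1. It is constant on either side of the support of
  \<open>\<xi>\<close>: the value is 0 on the left by the choice of the base point, and on the right
  because the integral of \<open>\<xi>\<close> vanishes.\<close>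

lemma test_function_antiderivative:
  assumes cont: "continuous_on UNIV \<xi>" and supp: "closure {x. \<xi> x \<noteq> 0} \<subseteq> {-1<..<0}"
    and int0: "(\<integral>x. \<xi> x \<partial>lebI) = 0"
  obtains \<phi> where "test_function \<phi>" "\<And>x. deriv \<phi> x = \<xi> x"
proof -
  define \<phi> where "\<phi> x = (LBINT y=ereal (-1)..ereal x. \<xi> y)" for x
  have der: "(\<phi> has_vector_derivative \<xi> x) (at x)" for x
  proof -
    \<comment> \<open>The interval extends beyond both \<open>x\<close> and -1, so \<open>x\<close>
      is interior to it and the derivative becomes two-sided.\<close>
    have "(\<phi> has_vector_derivative \<xi> x) (at x within {min x (-1) - 1..max x 0 + 1})"
      unfolding \<phi>_def
      by (rule interval_integral_FTC2) (auto intro: continuous_on_subset[OF cont])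
    moreover have "x \<in> interior {min x (-1) - 1..max x 0 + 1}" by auto
    ultimately show ?thesis by (simp only: at_within_interior)
  qed
  then have dr: "(\<phi> has_real_derivative \<xi> x) (at x)" for x
    by (simp add: has_real_derivative_iff_has_vector_derivative)
  have f1: "\<phi> (-1) = 0" by (simp add: \<phi>_def)
  have ci: "continuous_on {-1..0} \<xi>" by (rule continuous_on_subset[OF cont]) simp
  have "(\<xi> has_integral (\<phi> 0 - \<phi> (-1))) {-1..0}"
    by (rule fundamental_theorem_of_calculus) (auto intro: has_vector_derivative_at_within der)
  then have "integral {-1..0} \<xi> = \<phi> 0 - \<phi> (-1)" by (rule integral_unique)
  then have f0: "\<phi> 0 = 0"
    using int0 f1 lebesgue_integral_eq_integral[OF continuous_imp_integrable_real[OF ci]] by simp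
  have "bounded {x. \<xi> x \<noteq> 0}"
    by (rule bounded_subset[OF _ order.trans[OF closure_subset supp]]) simp
  then have comp: "compact (closure {x. \<xi> x \<noteq> 0})" by simp
  \<comment> \<open>A compact support keeps a positive distance from both end points:
    \<open>p\<close> and \<open>q\<close> are its extreme points. For an empty support -1/2 is an
    arbitrary choice.\<close>
  obtain p q where pq: "-1 < p" "q < 0" "closure {x. \<xi> x \<noteq> 0} \<subseteq> {p..q}"
  proof (cases "closure {x. \<xi> x \<noteq> 0} = {}")
    case True
    show ?thesis by (rule that[of "-1/2" "-1/2"]) (use True in auto)
  next
    case False
    obtain p where p: "p \<in> closure {x. \<xi> x \<noteq> 0}" "\<forall>y\<in>closure {x. \<xi> x \<noteq> 0}. p \<le> y"
      using compact_attains_inf[OF comp False] by blast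
    obtain q where q: "q \<in> closure {x. \<xi> x \<noteq> 0}" "\<forall>y\<in>closure {x. \<xi> x \<noteq> 0}. y \<le> q"
      using compact_attains_sup[OF comp False] by blast
    show ?thesis by (rule that[of p q]) (use p q supp in force)+
  qed
  have z: "\<xi> x = 0" if "x < p \<or> x > q" for x
    using that pq(3) closure_subset[of "{x. \<xi> x \<noteq> 0}"] by force
  have left: "\<phi> x = 0" if "x < p" for x
  proof -
    have "(\<phi> has_field_derivative 0) (at y within {..<p})" if "y \<in> {..<p}" for y
      using dr[of y] z[of y] that by (auto intro: has_field_derivative_at_within)
    then have "\<exists>c. \<forall>x\<in>{..<p}. \<phi> x = c"
      by (intro has_field_derivative_zero_constant) simp_all
    then show ?thesis using that pq(1) f1 by (metis lessThan_iff)
  qed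
  have right: "\<phi> x = 0" if "x > q" for x
  proof -
    have "(\<phi> has_field_derivative 0) (at y within {q<..})" if "y \<in> {q<..}" for y
      using dr[of y] z[of y] that by (auto intro: has_field_derivative_at_within)
    then have "\<exists>c. \<forall>x\<in>{q<..}. \<phi> x = c"
      by (intro has_field_derivative_zero_constant) simp_all
    then show ?thesis using that pq(2) f0 by (metis greaterThan_iff)
  qed
  have "x \<in> {p..q}" if "\<phi> x \<noteq> 0" for x
    using that left[of x] right[of x] by force
  then have "closure {x. \<phi> x \<noteq> 0} \<subseteq> {p..q}"
    by (intro closure_minimal) auto
  then have "closure {x. \<phi> x \<noteq> 0} \<subseteq> {-1<..<0}" using pq by force
  moreover have "\<phi> C1_differentiable_on UNIV"
    unfolding C1_differentiable_on_def using der cont by blast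
  ultimately have "test_function \<phi>" by (simp add: test_function_def)
  moreover have "deriv \<phi> x = \<xi> x" for x by (rule DERIV_imp_deriv[OF dr])
  ultimately show ?thesis by (rule that)
qed

text \<open>Subtracting a multiple of the bump \<open>\<beta>\<close> gives any admissible
  \<open>\<eta>\<close> mean zero and hence makes it the derivative of a test function. The
  hypothesis then says that \<open>h\<close> minus its \<open>\<beta>\<close>-weighted mean
  annihilates every \<open>\<eta>\<close>.\<close>

lemma du_Bois_Reymond:
  fixes h :: "real \<Rightarrow> 'a::euclidean_space"
  assumes h: "integrable lebI h"
    and zero: "\<And>\<phi>. test_function \<phi> \<Longrightarrow> (\<integral>x. deriv \<phi> x *\<^sub>R h x \<partial>lebI) = 0"
  obtains k where "AE x in lebI. h x = k"
proof -
  \<comment> \<open>A tent on \<open>{-3/4..-1/4}\<close>; what matters is its compact support in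
    the open interval and its nonzero integral.\<close>
  define \<beta> where "\<beta> x = max 0 (1/4 - \<bar>x + 1/2\<bar>)" for x :: real
  have cb: "continuous_on S \<beta>" for S unfolding \<beta>_def by (intro continuous_intros)
  have "closure {x. \<beta> x \<noteq> 0} \<subseteq> {-3/4..-1/4}"
    by (rule closure_minimal) (auto simp: \<beta>_def max_def abs_if split: if_splits)
  then have sb: "closure {x. \<beta> x \<noteq> 0} \<subseteq> {-1<..<0}" by force
  define I where "I = (\<integral>x. \<beta> x \<partial>lebI)"
  have I0: "I \<noteq> 0"
  proof
    assume "I = 0"
    then have "integral {-1..0} \<beta> = 0"
      unfolding I_def using lebesgue_integral_eq_integral[OF continuous_imp_integrable_real[OF cb]] by simp
    moreover have "\<beta> x \<ge> 0" for x by (simp add: \<beta>_def)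
    ultimately have "\<forall>x\<in>{-1..0}. \<beta> x = 0"
      using integral_eq_0_iff[OF cb, of "-1" 0] by simp
    then have "\<beta> (-1/2) = 0" by auto
    then show False by (simp add: \<beta>_def)
  qed
  define k where "k = (1 / I) *\<^sub>R (\<integral>x. \<beta> x *\<^sub>R h x \<partial>lebI)"
  interpret finite_measure lebI by (rule finite_measure_lebesgue_on) simp
  have "AE x in lebI. h x - k = 0"
  proof (rule AE_zero_if_integrals_zero)
    show hk: "integrable lebI (\<lambda>x. h x - k)" using h by simp
    fix \<eta> :: "real \<Rightarrow> real"
    assume ce: "continuous_on UNIV \<eta>" and se: "closure {x. \<eta> x \<noteq> 0} \<subseteq> {-1<..<0}"
    have ce': "continuous_on {-1..0} \<eta>" by (rule continuous_on_subset[OF ce]) simp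
    define J where "J = (\<integral>x. \<eta> x \<partial>lebI)"
    define \<xi> where "\<xi> x = \<eta> x - (J / I) * \<beta> x" for x
    have ie: "integrable lebI \<eta>" and ib: "integrable lebI \<beta>"
      by (intro continuous_imp_integrable_real ce' cb)+
    have "{x. \<xi> x \<noteq> 0} \<subseteq> {x. \<eta> x \<noteq> 0} \<union> {x. \<beta> x \<noteq> 0}" by (auto simp: \<xi>_def)
    then have "closure {x. \<xi> x \<noteq> 0} \<subseteq> closure {x. \<eta> x \<noteq> 0} \<union> closure {x. \<beta> x \<noteq> 0}"
      by (metis closure_Un closure_mono)
    then have sx: "closure {x. \<xi> x \<noteq> 0} \<subseteq> {-1<..<0}" using se sb by blast
    have cx: "continuous_on UNIV \<xi>" unfolding \<xi>_def by (intro continuous_intros ce cb)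
    have "(\<integral>x. \<xi> x \<partial>lebI) = J - (J / I) * I"
      unfolding \<xi>_def using ie ib by (simp add: J_def I_def)
    then have "(\<integral>x. \<xi> x \<partial>lebI) = 0" using I0 by simp
    then obtain \<phi> where "test_function \<phi>" "\<And>x. deriv \<phi> x = \<xi> x"
      using test_function_antiderivative[OF cx sx] by blast
    then have "0 = (\<integral>x. \<xi> x *\<^sub>R h x \<partial>lebI)" using zero[of \<phi>] by simp
    also have "\<dots> = (\<integral>x. (\<eta> x *\<^sub>R h x - (J / I) *\<^sub>R (\<beta> x *\<^sub>R h x)) \<partial>lebI)"
      by (simp add: \<xi>_def scaleR_left_diff_distrib)
    also have "\<dots> = (\<integral>x. \<eta> x *\<^sub>R h x \<partial>lebI) - J *\<^sub>R k"
      unfolding Bochner_Integration.integral_diff[OF integrable_lebI_continuous_scaleR[OF ce' h]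
          integrable_scaleR_right[OF integrable_lebI_continuous_scaleR[OF cb h]]]
      by (simp only: integral_scaleR_right k_def) simp
    also have "\<dots> = (\<integral>x. \<eta> x *\<^sub>R (h x - k) \<partial>lebI)"
      using integrable_lebI_continuous_scaleR[OF ce' h] ie
      by (simp add: scaleR_right_diff_distrib J_def)
    finally show "(\<integral>x. \<eta> x *\<^sub>R (h x - k) \<partial>lebI) = 0" by simp
  qed
  then have "AE x in lebI. h x = k" by simp
  then show ?thesis by (rule that)
qed

text \<open>Integration by parts expresses the integral of \<open>p x *\<^sub>R h x\<close>, for a
  polynomial \<open>p\<close>, through tail integrals of \<open>h\<close>, so it vanishes. Uniform
  approximation extends this to continuous \<open>\<eta>\<close>, and the fundamental lemma
  applies.\<close>

lemma AE_zero_if_tail_integrals_zero: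
  fixes h :: "real \<Rightarrow> 'a::euclidean_space"
  assumes h: "integrable lebI h"
    and zero: "\<And>a. a \<in> {-1..0} \<Longrightarrow> integral {a..0} h = 0"
  shows "AE x in lebI. h x = 0"
proof (rule AE_zero_if_integrals_zero[OF h])
  fix \<eta> :: "real \<Rightarrow> real"
  assume "continuous_on UNIV \<eta>"
  then have ce: "continuous_on {-1..0} \<eta>" by (rule continuous_on_subset) simp
  define N where "N = (\<integral>x. norm (h x) \<partial>lebI)"
  have N0: "N \<ge> 0" by (simp add: N_def)
  have "norm (\<integral>x. \<eta> x *\<^sub>R h x \<partial>lebI) \<le> 0 + e" if e: "e > 0" for e
  proof -
    \<comment> \<open>The approximation error is at most \<open>d * N\<close>; the summand 1 keeps
      the denominator positive when \<open>N\<close> is 0.\<close>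
    define d where "d = e / (N + 1)"
    have d: "d > 0" using e N0 by (simp add: d_def)
    obtain p where p: "polynomial_function p" "\<And>x. x \<in> {-1..0} \<Longrightarrow> norm (\<eta> x - p x) < d"
      using Stone_Weierstrass_polynomial_function[OF compact_Icc ce d] by blast
    obtain p' where p': "polynomial_function p'" "\<And>x. (p has_vector_derivative p' x) (at x)"
      using has_vector_derivative_polynomial_function[OF p(1)] by blast
    have cp: "continuous_on {-1..0} p"
      by (rule continuous_on_polymonial_function[OF p(1)])
    have "(\<integral>x. p x *\<^sub>R h x \<partial>lebI) = p (-1) *\<^sub>R integral {-1..0} h + integral {-1..0} (\<lambda>a. p' a *\<^sub>R integral {a..0} h)"
      by (rule integration_by_parts_tail_scaleR[OF _ _ h])
        (auto intro!: has_vector_derivative_at_within p'(2) continuous_on_polymonial_function p'(1))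
    also have "\<dots> = 0"
      using zero Henstock_Kurzweil_Integration.integral_cong[of "{-1..0}" "\<lambda>a. p' a *\<^sub>R integral {a..0} h" "\<lambda>_. 0"]
      by simp
    finally have p0: "(\<integral>x. p x *\<^sub>R h x \<partial>lebI) = 0" .
    have "(\<integral>x. \<eta> x *\<^sub>R h x \<partial>lebI) = (\<integral>x. \<eta> x *\<^sub>R h x - p x *\<^sub>R h x \<partial>lebI)"
      using integrable_lebI_continuous_scaleR[OF cp h] integrable_lebI_continuous_scaleR[OF ce h] p0 by simp
    then have "norm (\<integral>x. \<eta> x *\<^sub>R h x \<partial>lebI) \<le> (\<integral>x. norm (\<eta> x *\<^sub>R h x - p x *\<^sub>R h x) \<partial>lebI)"
      by simp
    also have "\<dots> \<le> (\<integral>x. d * norm (h x) \<partial>lebI)"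
    proof (rule integral_mono_AE)
      show "AE x in lebI. norm (\<eta> x *\<^sub>R h x - p x *\<^sub>R h x) \<le> d * norm (h x)"
        using p(2) by (intro AE_I2) (auto simp: scaleR_left_diff_distrib[symmetric] less_imp_le intro!: mult_right_mono)
    qed (use h integrable_lebI_continuous_scaleR[OF cp h] integrable_lebI_continuous_scaleR[OF ce h] in auto)
    also have "\<dots> = d * N" by (simp add: N_def)
    also have "\<dots> \<le> e" using e N0 by (simp add: d_def field_simps)
    finally show ?thesis by simp
  qed
  then have "norm (\<integral>x. \<eta> x *\<^sub>R h x \<partial>lebI) \<le> 0" by (rule field_le_epsilon)
  then show "(\<integral>x. \<eta> x *\<^sub>R h x \<partial>lebI) = 0" by simp
qed

section \<open>Weak derivatives in \<open>L\<^sub>2\<close>\<close>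

lemma L2_eq_refl_iff: "L2_eq f f \<longleftrightarrow> square_integrable f"
  by (simp add: L2_eq_def)

lemma square_integrable_rep_L2: "square_integrable (rep_L2 u)"
  using Quotient3_rep_reflp[OF Quotient3_L2] by (simp add: L2_eq_refl_iff)

lemma to_L2_rep_L2: "to_L2 (rep_L2 u) = u"
  unfolding to_L2_def by (rule Quotient3_abs_rep[OF Quotient3_L2])

lemma to_L2_eq_iff:
  assumes "square_integrable f" "square_integrable g"
  shows "to_L2 f = to_L2 g \<longleftrightarrow> (AE \<theta> in lebI. f \<theta> = g \<theta>)"
  using Quotient3_rel[OF Quotient3_L2, of f g] assms by (auto simp: to_L2_def L2_eq_def)

lemma inner_to_L2:
  assumes "square_integrable f" "square_integrable g"
  shows "to_L2 f \<bullet> to_L2 g = (\<integral>\<theta>. f \<theta> \<bullet> g \<theta> \<partial>lebI)"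
  unfolding to_L2_def using assms by (simp add: inner_L2.abs_eq L2_eq_refl_iff)

lemma integrable_square_integrable:
  assumes "square_integrable f"
  shows "integrable lebI f"
proof -
  interpret finite_measure lebI by (rule finite_measure_lebesgue_on) simp
  show ?thesis
  proof (rule Bochner_Integration.integrable_bound)
    show "integrable lebI (\<lambda>x. 1 + (norm (f x))\<^sup>2)"
      using assms by (simp add: square_integrable_def)
    have "norm a \<le> 1 + (norm a)\<^sup>2" for a :: 'a
      using sum_squares_bound[of 1 "norm a"] norm_ge_zero[of a] unfolding power_one mult_1_right by linarith
    then show "AE x in lebI. norm (f x) \<le> norm (1 + (norm (f x))\<^sup>2)"
      by (intro AE_I2) (auto intro: order.trans[OF _ abs_ge_self])
  qed (use assms in \<open>simp add: square_integrable_def\<close>)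
qed

lemma square_integrable_continuous:
  fixes c :: "real \<Rightarrow> 'a::euclidean_space"
  assumes "continuous_on {-1..0} c"
  shows "square_integrable c"
  unfolding square_integrable_def
  using continuous_imp_measurable_on_sets_lebesgue[OF assms]
  by (auto intro!: continuous_imp_integrable_real continuous_intros assms)

lemma square_integrable_indicator: "square_integrable (\<lambda>\<theta>. indicat_real {a..b} \<theta> *\<^sub>R v)"
proof -
  interpret finite_measure lebI by (rule finite_measure_lebesgue_on) simp
  have m: "indicat_real {a..b} \<in> borel_measurable lebI"
    by (intro measurable_restrict_space1 borel_measurable_indicator) simp
  show ?thesis
    unfolding square_integrable_def
  proof
    show "(\<lambda>\<theta>. indicat_real {a..b} \<theta> *\<^sub>R v) \<in> borel_measurable lebI" using m by simp
    show "integrable lebI (\<lambda>\<theta>. (norm (indicat_real {a..b} \<theta> *\<^sub>R v))\<^sup>2)"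
    proof (rule Bochner_Integration.integrable_bound[of _ "\<lambda>_. (norm v)\<^sup>2"])
      show "AE x in lebI. norm ((norm (indicat_real {a..b} x *\<^sub>R v))\<^sup>2) \<le> norm ((norm v)\<^sup>2)"
        by (intro AE_I2) (auto simp: indicator_def)
    qed (use m in simp_all)
  qed
qed

lemma L2_at_to_L2:
  fixes c :: "real \<Rightarrow> 'a::euclidean_space"
  assumes "continuous_on {-1..0} c" "\<theta> \<in> {-1..0}"
  shows "L2_at (to_L2 c) \<theta> = c \<theta>"
  unfolding L2_at_def
proof (rule the_equality)
  fix v assume "\<exists>c'. continuous_on {-1..0} c' \<and> to_L2 c' = to_L2 c \<and> c' \<theta> = v"
  then obtain c' where c': "continuous_on {-1..0} c'" "to_L2 c' = to_L2 c" "c' \<theta> = v" by blast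
  have "AE x in lebI. c' x = c x"
    using c'(2) to_L2_eq_iff square_integrable_continuous c'(1) assms(1) by blast
  then have "AE x in lebI. c' x - c x = 0" by simp
  then have "c' \<theta> - c \<theta> = 0"
    by (intro continuous_AE_eq_0[of "\<lambda>x. c' x - c x"] continuous_intros c' assms)
  then show "v = c \<theta>" using c'(3) by simp
qed (use assms in auto)

lemma test_function_deriv:
  assumes "test_function \<phi>"
  shows "(\<phi> has_vector_derivative deriv \<phi> x) (at x)"
    and "continuous_on S (deriv \<phi>)"
    and "x \<notin> {-1<..<0} \<Longrightarrow> \<phi> x = 0"
proof -
  obtain D where D: "\<And>x. (\<phi> has_vector_derivative D x) (at x)" "continuous_on UNIV D"
    using assms by (auto simp: test_function_def C1_differentiable_on_def)
  have "deriv \<phi> = D"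
    using D(1) by (auto simp: has_real_derivative_iff_has_vector_derivative intro!: ext DERIV_imp_deriv)
  then show "(\<phi> has_vector_derivative deriv \<phi> x) (at x)" "continuous_on S (deriv \<phi>)"
    using D continuous_on_subset[OF D(2) subset_UNIV] by auto
  have "{\<theta>. \<phi> \<theta> \<noteq> 0} \<subseteq> {-1<..<0}"
    using assms order.trans[OF closure_subset] unfolding test_function_def by blast
  then show "x \<notin> {-1<..<0} \<Longrightarrow> \<phi> x = 0" by blast
qed

text \<open>With \<open>G\<close> the tail integral of \<open>g\<close>, integration by parts makes
  the sum of \<open>rep_L2 u\<close> and \<open>G\<close> orthogonal to all derivatives of test
  functions, hence constant almost everywhere. That constant is the value of the continuous
  representative at 0.\<close>

lemma has_weak_derivative_primitive:
  fixes u g :: "'a::euclidean_space L2"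
  assumes "u has_weak_derivative g"
  obtains c where "continuous_on {-1..0} c" "u = to_L2 c"
    "\<And>a. a \<in> {-1..0} \<Longrightarrow> integral {a..0} (rep_L2 g) = c 0 - c a"
proof -
  define G where "G a = integral {a..0} (rep_L2 g)" for a
  have ig: "integrable lebI (rep_L2 g)" and iu: "integrable lebI (rep_L2 u)"
    by (intro integrable_square_integrable square_integrable_rep_L2)+
  have cG: "continuous_on {-1..0} G"
    unfolding G_def using ig by (intro indefinite_integral_continuous_1' integrable_on_lebesgue_on) auto
  then have iG: "integrable lebI G" by (rule continuous_imp_integrable_real)
  have "(\<integral>x. deriv \<phi> x *\<^sub>R (rep_L2 u x + G x) \<partial>lebI) = 0" if t: "test_function \<phi>" for \<phi>
  proof -
    note td = test_function_deriv[OF t]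
    have "(\<integral>x. deriv \<phi> x *\<^sub>R (rep_L2 u x + G x) \<partial>lebI) =
        (\<integral>x. deriv \<phi> x *\<^sub>R rep_L2 u x \<partial>lebI) + (\<integral>x. deriv \<phi> x *\<^sub>R G x \<partial>lebI)"
      unfolding scaleR_add_right
      by (intro Bochner_Integration.integral_add integrable_lebI_continuous_scaleR td iu iG)
    also have "(\<integral>x. deriv \<phi> x *\<^sub>R rep_L2 u x \<partial>lebI) = - (\<integral>x. \<phi> x *\<^sub>R rep_L2 g x \<partial>lebI)"
      using assms t by (simp add: has_weak_derivative_def)
    also have "(\<integral>x. \<phi> x *\<^sub>R rep_L2 g x \<partial>lebI) =
        \<phi> (-1) *\<^sub>R integral {-1..0} (rep_L2 g) + integral {-1..0} (\<lambda>a. deriv \<phi> a *\<^sub>R integral {a..0} (rep_L2 g))"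
      by (rule integration_by_parts_tail_scaleR[OF _ _ ig]) (auto intro: has_vector_derivative_at_within td)
    \<comment> \<open>The boundary term vanishes since \<open>\<phi>\<close> is 0 at -1.\<close>
    also have "\<dots> = integral {-1..0} (\<lambda>a. deriv \<phi> a *\<^sub>R G a)"
      using td(3)[of "-1"] by (simp add: G_def)
    also have "\<dots> = (\<integral>x. deriv \<phi> x *\<^sub>R G x \<partial>lebI)"
      by (intro lebesgue_integral_eq_integral[symmetric] integrable_lebI_continuous_scaleR td iG) auto
    finally show ?thesis by simp
  qed
  then obtain k where k: "AE x in lebI. rep_L2 u x + G x = k"
    using du_Bois_Reymond[of "\<lambda>x. rep_L2 u x + G x"] iu iG by auto
  define c where "c x = k - G x" for x
  have cc: "continuous_on {-1..0} c" unfolding c_def by (intro continuous_intros cG)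
  have "AE x in lebI. rep_L2 u x = c x" using k by eventually_elim (auto simp: c_def algebra_simps)
  then have "u = to_L2 c"
    using to_L2_eq_iff[OF square_integrable_rep_L2 square_integrable_continuous[OF cc], of u] by (simp add: to_L2_rep_L2)
  then show ?thesis by (rule that[OF cc]) (simp add: c_def, simp add: G_def)
qed

text \<open>The tail integrals of \<open>g1\<close> and \<open>g2\<close> are the same increments of
  the continuous representative of \<open>u\<close>, and tail integrals determine a function almost
  everywhere. This justifies the definite description in \<open>weak_deriv\<close>.\<close>

lemma has_weak_derivative_unique:
  fixes u g1 g2 :: "'a::euclidean_space L2"
  assumes "u has_weak_derivative g1" "u has_weak_derivative g2"
  shows "g1 = g2"
proof -
  obtain c1 where c1: "continuous_on {-1..0} c1" "u = to_L2 c1"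
    "\<And>a. a \<in> {-1..0} \<Longrightarrow> integral {a..0} (rep_L2 g1) = c1 0 - c1 a"
    using has_weak_derivative_primitive[OF assms(1)] by blast
  obtain c2 where c2: "continuous_on {-1..0} c2" "u = to_L2 c2"
    "\<And>a. a \<in> {-1..0} \<Longrightarrow> integral {a..0} (rep_L2 g2) = c2 0 - c2 a"
    using has_weak_derivative_primitive[OF assms(2)] by blast
  have eq: "c1 a = c2 a" if "a \<in> {-1..0}" for a
    using L2_at_to_L2[OF c1(1) that] L2_at_to_L2[OF c2(1) that] c1(2) c2(2) by simp
  have i: "integrable lebI (rep_L2 g1)" "integrable lebI (rep_L2 g2)"
    by (intro integrable_square_integrable square_integrable_rep_L2)+
  have "AE x in lebI. rep_L2 g1 x - rep_L2 g2 x = 0"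
  proof (rule AE_zero_if_tail_integrals_zero)
    fix a :: real assume a: "a \<in> {-1..0}"
    have "rep_L2 g1 integrable_on {a..0}" "rep_L2 g2 integrable_on {a..0}"
      using i[THEN integrable_on_lebesgue_on] a by (auto intro: integrable_on_subinterval)
    then have "integral {a..0} (\<lambda>x. rep_L2 g1 x - rep_L2 g2 x) = (c1 0 - c1 a) - (c2 0 - c2 a)"
      using a by (simp add: Henstock_Kurzweil_Integration.integral_diff c1(3) c2(3))
    then show "integral {a..0} (\<lambda>x. rep_L2 g1 x - rep_L2 g2 x) = 0" using a eq by simp
  qed (use i in simp)
  then have "to_L2 (rep_L2 g1) = to_L2 (rep_L2 g2)"
    by (subst to_L2_eq_iff) (simp_all add: square_integrable_rep_L2)
  then show ?thesis by (simp add: to_L2_rep_L2)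
qed

text \<open>Collects what the transport argument uses about \<open>H1\<close>: a continuous
  representative that gives the boundary values and whose increments are the tail integrals of
  \<open>weak_deriv u\<close>.\<close>

lemma H1_primitive:
  fixes u :: "'a::euclidean_space L2"
  assumes "u \<in> H1"
  obtains c where "continuous_on {-1..0} c" "u = to_L2 c"
    "\<And>a. a \<in> {-1..0} \<Longrightarrow> L2_at u a = c a"
    "\<And>a. a \<in> {-1..0} \<Longrightarrow> integral {a..0} (rep_L2 (weak_deriv u)) = c 0 - c a"
proof -
  obtain g where g: "u has_weak_derivative g" using assms by (auto simp: H1_def)
  have "weak_deriv u = g"
    unfolding weak_deriv_def using g has_weak_derivative_unique by (intro the_equality) blast+
  then show ?thesis
    using has_weak_derivative_primitive[OF g] that L2_at_to_L2 by metis
qed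

section \<open>Tail integrals and transport along characteristics\<close>

text \<open>The limit form of the derivative, suited to norm estimates and to sequences. Dividing
  the remainder by \<open>norm (y - x)\<close> instead of \<open>y - x\<close> changes at most its
  sign, which the norm removes.\<close>

lemma has_vector_derivative_quotient:
  assumes "(f has_vector_derivative D) (at x within S)"
  shows "((\<lambda>y. (1 / (y - x)) *\<^sub>R (f y - f x)) \<longlongrightarrow> D) (at x within S)"
proof -
  have "((\<lambda>y. ((f y - f x) - (y - x) *\<^sub>R D) /\<^sub>R norm (y - x)) \<longlongrightarrow> 0) (at x within S)"
    using assms by (simp add: has_vector_derivative_def has_derivative_at_within)
  then have "((\<lambda>y. norm (((f y - f x) - (y - x) *\<^sub>R D) /\<^sub>R norm (y - x))) \<longlongrightarrow> 0) (at x within S)"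
    by (rule tendsto_norm_zero)
  moreover have "\<forall>\<^sub>F y in at x within S. norm (((f y - f x) - (y - x) *\<^sub>R D) /\<^sub>R norm (y - x)) =
      norm ((1 / (y - x)) *\<^sub>R (f y - f x) - D)"
    unfolding eventually_at_filter
  proof (intro always_eventually allI impI)
    fix y assume "y \<noteq> x"
    then have "(1 / (y - x)) *\<^sub>R (f y - f x) - D = (1 / (y - x)) *\<^sub>R ((f y - f x) - (y - x) *\<^sub>R D)"
      by (simp add: scaleR_diff_right)
    then show "norm (((f y - f x) - (y - x) *\<^sub>R D) /\<^sub>R norm (y - x)) = norm ((1 / (y - x)) *\<^sub>R (f y - f x) - D)"
      by (simp add: divide_inverse)
  qed
  ultimately have "((\<lambda>y. norm ((1 / (y - x)) *\<^sub>R (f y - f x) - D)) \<longlongrightarrow> 0) (at x within S)"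
    by (rule Lim_transform_eventually)
  then show ?thesis by (rule LIM_zero_cancel[OF tendsto_norm_zero_cancel])
qed

text \<open>Differentiation under the integral sign: a bound on \<open>f'\<close> over a compact
  interval dominates the difference quotients by a multiple of \<open>norm (g \<tau>)\<close>, and
  dominated convergence is applied along sequences tending to \<open>t\<close>.\<close>

lemma leibniz_delay:
  fixes f :: "real \<Rightarrow> 'a::euclidean_space"
  assumes f: "\<And>t. t \<ge> 0 \<Longrightarrow> (f has_vector_derivative f' t) (at t within {0..})"
    and f': "continuous_on {0..} f'" and g: "integrable lebI g" and t: "t \<ge> 0"
  shows "((\<lambda>t. \<integral>\<tau>. f (t + 1 + \<tau>) \<bullet> g \<tau> \<partial>lebI) has_vector_derivative
    (\<integral>\<tau>. f' (t + 1 + \<tau>) \<bullet> g \<tau> \<partial>lebI)) (at t within {0..})"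
proof -
  have cf: "continuous_on {0..} f"
    using f has_vector_derivative_continuous by (force simp: continuous_on_eq_continuous_within)
  have cf_shift: "continuous_on {-1..0} (\<lambda>\<tau>. f (s + 1 + \<tau>))" if "s \<ge> 0" for s
    by (rule continuous_on_compose2[OF cf]) (use that in \<open>auto intro!: continuous_intros\<close>)
  have cf'_shift: "continuous_on {-1..0} (\<lambda>\<tau>. f' (s + 1 + \<tau>))" if "s \<ge> 0" for s
    by (rule continuous_on_compose2[OF f']) (use that in \<open>auto intro!: continuous_intros\<close>)
  have int: "integrable lebI (\<lambda>\<tau>. f (s + 1 + \<tau>) \<bullet> g \<tau>)" if "s \<ge> 0" for s
    by (intro integrable_lebI_continuous_inner cf_shift g that)
  define F where "F s = (\<integral>\<tau>. f (s + 1 + \<tau>) \<bullet> g \<tau> \<partial>lebI)" for s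
  have "((\<lambda>s. (F s - F t) / (s - t)) \<longlongrightarrow> (\<integral>\<tau>. f' (t + 1 + \<tau>) \<bullet> g \<tau> \<partial>lebI)) (at t within {0..})"
    unfolding tendsto_at_iff_sequentially
  proof (intro allI impI)
    fix X :: "nat \<Rightarrow> real"
    assume "\<forall>i. X i \<in> {0..} - {t}" and lim: "X \<longlonglongrightarrow> t"
    then have X: "X i \<ge> 0" "X i \<noteq> t" for i by auto
    obtain M where M: "\<And>i. \<bar>X i\<bar> \<le> M"
      using convergent_imp_Bseq[of X] lim by (auto simp: convergent_def Bseq_def)
    \<comment> \<open>All arguments \<open>X i + 1 + \<tau>\<close> and
      \<open>t + 1 + \<tau>\<close> stay in the compact interval \<open>{0..M' + 1}\<close>, on
      which \<open>f'\<close> is bounded by \<open>K\<close>.\<close>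
    define M' where "M' = max M t"
    have M': "X i \<le> M'" "t \<le> M'" for i using M[of i] by (auto simp: M'_def)
    have "compact (f' ` {0..M' + 1})"
      by (intro compact_continuous_image compact_Icc continuous_on_subset[OF f']) auto
    then have "bounded (f' ` {0..M' + 1})" by (rule compact_imp_bounded)
    then obtain K where K: "\<And>s. s \<in> {0..M' + 1} \<Longrightarrow> norm (f' s) \<le> K"
      unfolding bounded_iff by blast
    have mv: "norm (f a - f b) \<le> K * norm (a - b)" if "a \<in> {0..M' + 1}" "b \<in> {0..M' + 1}" for a b
    proof (rule differentiable_bound[of "{0..M' + 1}" f "\<lambda>s h. h *\<^sub>R f' s"])
      fix s assume s: "s \<in> {0..M' + 1}"
      have "(f has_vector_derivative f' s) (at s within {0..M' + 1})"
        using s by (intro has_vector_derivative_within_subset[OF f]) auto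
      then show "(f has_derivative (\<lambda>h. h *\<^sub>R f' s)) (at s within {0..M' + 1})"
        by (simp add: has_vector_derivative_def)
      show "onorm (\<lambda>h. h *\<^sub>R f' s) \<le> K"
        using K[OF s] by (simp add: onorm_scaleR_left[OF bounded_linear_ident] onorm_id)
    qed (use that in auto)
    have quot: "(F (X i) - F t) / (X i - t) = (\<integral>\<tau>. ((1 / (X i - t)) *\<^sub>R (f (X i + 1 + \<tau>) - f (t + 1 + \<tau>))) \<bullet> g \<tau> \<partial>lebI)" for i
    proof -
      have "F (X i) - F t = (\<integral>\<tau>. f (X i + 1 + \<tau>) \<bullet> g \<tau> - f (t + 1 + \<tau>) \<bullet> g \<tau> \<partial>lebI)"
        unfolding F_def using int[OF X(1)] int[OF t] by simp
      then show ?thesis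
        by (simp add: inner_diff_left divide_inverse mult.commute)
    qed
    have "(\<lambda>i. \<integral>\<tau>. ((1 / (X i - t)) *\<^sub>R (f (X i + 1 + \<tau>) - f (t + 1 + \<tau>))) \<bullet> g \<tau> \<partial>lebI)
        \<longlonglongrightarrow> (\<integral>\<tau>. f' (t + 1 + \<tau>) \<bullet> g \<tau> \<partial>lebI)"
    proof (rule integral_dominated_convergence[of _ _ _ "\<lambda>\<tau>. K * norm (g \<tau>)"])
      show "(\<lambda>\<tau>. f' (t + 1 + \<tau>) \<bullet> g \<tau>) \<in> borel_measurable lebI"
        by (intro borel_measurable_integrable integrable_lebI_continuous_inner cf'_shift g t)
      show "(\<lambda>\<tau>. ((1 / (X i - t)) *\<^sub>R (f (X i + 1 + \<tau>) - f (t + 1 + \<tau>))) \<bullet> g \<tau>) \<in> borel_measurable lebI" for i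
        by (intro borel_measurable_integrable integrable_lebI_continuous_inner continuous_intros cf_shift g t X)
      show "integrable lebI (\<lambda>\<tau>. K * norm (g \<tau>))" using g by simp
      show "AE \<tau> in lebI. norm (((1 / (X i - t)) *\<^sub>R (f (X i + 1 + \<tau>) - f (t + 1 + \<tau>))) \<bullet> g \<tau>) \<le> K * norm (g \<tau>)" for i
      proof (rule AE_I2)
        fix \<tau> assume "\<tau> \<in> space lebI"
        then have "norm (f (X i + 1 + \<tau>) - f (t + 1 + \<tau>)) \<le> K * norm ((X i + 1 + \<tau>) - (t + 1 + \<tau>))"
          using M'(1)[of i] M'(2) X[of i] t by (intro mv) auto
        then have "norm (f (X i + 1 + \<tau>) - f (t + 1 + \<tau>)) / \<bar>X i - t\<bar> \<le> K"
          using X(2)[of i] by (simp add: pos_divide_le_eq)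
        then have "norm ((1 / (X i - t)) *\<^sub>R (f (X i + 1 + \<tau>) - f (t + 1 + \<tau>))) \<le> K"
          unfolding norm_scaleR by simp
        then show "norm (((1 / (X i - t)) *\<^sub>R (f (X i + 1 + \<tau>) - f (t + 1 + \<tau>))) \<bullet> g \<tau>) \<le> K * norm (g \<tau>)"
          unfolding real_norm_def by (intro order.trans[OF Cauchy_Schwarz_ineq2] mult_right_mono) auto
      qed
      show "AE \<tau> in lebI. (\<lambda>i. ((1 / (X i - t)) *\<^sub>R (f (X i + 1 + \<tau>) - f (t + 1 + \<tau>))) \<bullet> g \<tau>) \<longlonglongrightarrow> f' (t + 1 + \<tau>) \<bullet> g \<tau>"
      proof (rule AE_I2)
        fix \<tau> assume "\<tau> \<in> space lebI"
        then have s: "t + 1 + \<tau> \<ge> 0" and s': "\<And>i. X i + 1 + \<tau> \<ge> 0" using t X by (auto simp: add.assoc)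
        have Q: "((\<lambda>y. (1 / (y - (t + 1 + \<tau>))) *\<^sub>R (f y - f (t + 1 + \<tau>))) \<longlongrightarrow> f' (t + 1 + \<tau>)) (at (t + 1 + \<tau>) within {0..})"
          by (rule has_vector_derivative_quotient[OF f[OF s]])
        have "(\<lambda>i. X i + 1 + \<tau>) \<longlonglongrightarrow> t + 1 + \<tau>" by (intro tendsto_intros lim)
        then have "(\<lambda>i. (1 / (X i + 1 + \<tau> - (t + 1 + \<tau>))) *\<^sub>R (f (X i + 1 + \<tau>) - f (t + 1 + \<tau>))) \<longlonglongrightarrow> f' (t + 1 + \<tau>)"
          using Q[unfolded tendsto_at_iff_sequentially, rule_format, of "\<lambda>i. X i + 1 + \<tau>"] s' X(2)
          by (simp add: o_def)
        then show "(\<lambda>i. ((1 / (X i - t)) *\<^sub>R (f (X i + 1 + \<tau>) - f (t + 1 + \<tau>))) \<bullet> g \<tau>) \<longlonglongrightarrow> f' (t + 1 + \<tau>) \<bullet> g \<tau>"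
          by (intro tendsto_intros) simp
      qed
    qed
    then show "((\<lambda>s. (F s - F t) / (s - t)) \<circ> X) \<longlonglongrightarrow> (\<integral>\<tau>. f' (t + 1 + \<tau>) \<bullet> g \<tau> \<partial>lebI)"
      by (simp add: o_def quot)
  qed
  then show ?thesis
    by (simp only: F_def has_field_derivative_iff has_real_derivative_iff_has_vector_derivative[symmetric])
qed

text \<open>Encodes the tail integral over \<open>{a..0}\<close>, tested against \<open>v\<close>,
  as the pairing with an element of the Hilbert space, so that it can be differentiated along
  \<open>L2\<close>-valued functions of time.\<close>

definition tail_indicator :: "real \<Rightarrow> 'a::euclidean_space \<Rightarrow> 'a L2" where
  "tail_indicator a v = to_L2 (\<lambda>\<theta>. indicat_real {a..0} \<theta> *\<^sub>R v)"

lemma inner_tail_indicator: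
  assumes f: "square_integrable f" and a: "a \<in> {-1..0}"
  shows "to_L2 f \<bullet> tail_indicator a v = integral {a..0} f \<bullet> v"
proof -
  have i: "integrable (lebesgue_on {a..0}) f"
    by (rule integrable_subinterval[OF integrable_square_integrable[OF f]]) (use a in auto)
  have "to_L2 f \<bullet> tail_indicator a v = (\<integral>\<theta>. f \<theta> \<bullet> (indicat_real {a..0} \<theta> *\<^sub>R v) \<partial>lebI)"
    unfolding tail_indicator_def by (intro inner_to_L2 f square_integrable_indicator)
  also have "\<dots> = (\<integral>\<theta>. (if \<theta> \<in> {a..0} then f \<theta> \<bullet> v else 0) \<partial>lebI)"
    by (intro Bochner_Integration.integral_cong) (auto simp: indicator_def)
  also have "\<dots> = (\<integral>\<theta>. f \<theta> \<bullet> v \<partial>lebesgue_on {a..0})"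
    using a by (intro integral_restrict) auto
  also have "\<dots> = integral {a..0} f \<bullet> v"
    using i by (simp add: lebesgue_integral_eq_integral)
  finally show ?thesis .
qed

lemma inner_tail_indicator_rep:
  assumes "a \<in> {-1..0}"
  shows "u \<bullet> tail_indicator a v = integral {a..0} (rep_L2 u) \<bullet> v"
  using inner_tail_indicator[OF square_integrable_rep_L2 assms, of u v] by (simp add: to_L2_rep_L2)

lemma continuous_on_inner_tail_indicator:
  "continuous_on {-1..0} (\<lambda>a. u \<bullet> tail_indicator a v)"
proof -
  have "continuous_on {-1..0} (\<lambda>a. integral {a..0} (rep_L2 u) \<bullet> v)"
    by (intro continuous_intros indefinite_integral_continuous_1' integrable_on_lebesgue_on
        integrable_square_integrable square_integrable_rep_L2) simp
  then show ?thesis by (rule continuous_on_eq) (simp add: inner_tail_indicator_rep)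
qed

text \<open>The norm is \<open>sqrt (- a) * norm v\<close>; the product rule below uses a bound
  uniform in \<open>a\<close>.\<close>

lemma norm_tail_indicator_le:
  assumes "a \<in> {-1..0}"
  shows "norm (tail_indicator a v) \<le> norm v"
proof -
  have "tail_indicator a v \<bullet> tail_indicator a v = integral {a..0} (\<lambda>\<theta>. indicat_real {a..0} \<theta> *\<^sub>R v) \<bullet> v"
    using inner_tail_indicator[OF square_integrable_indicator assms, of a 0 v v]
    by (simp add: tail_indicator_def)
  also have "integral {a..0} (\<lambda>\<theta>. indicat_real {a..0} \<theta> *\<^sub>R v) = integral {a..0} (\<lambda>\<theta>. v)"
    by (rule Henstock_Kurzweil_Integration.integral_cong) simp
  also have "\<dots> = (- a) *\<^sub>R v" using assms by simp
  also have "((- a) *\<^sub>R v) \<bullet> v = (- a) * (norm v)\<^sup>2" by (simp add: power2_norm_eq_inner)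
  also have "\<dots> \<le> 1 * (norm v)\<^sup>2" using assms by (intro mult_right_mono) auto
  finally have "(norm (tail_indicator a v))\<^sup>2 \<le> (norm v)\<^sup>2" by (simp add: power2_norm_eq_inner)
  then show ?thesis by (rule power2_le_imp_le) simp
qed

lemma moving_tail_derivative:
  fixes r :: "real \<Rightarrow> 'a::euclidean_space L2"
  assumes r: "(r has_vector_derivative r') (at s within {-1..0})" and s: "s \<in> {-1..0}"
    and d: "((\<lambda>\<sigma>. r s \<bullet> tail_indicator \<sigma> v) has_vector_derivative d) (at s within {-1..0})"
  shows "((\<lambda>\<sigma>. r \<sigma> \<bullet> tail_indicator \<sigma> v) has_vector_derivative (r' \<bullet> tail_indicator s v + d)) (at s within {-1..0})"
proof -
  define q where "q \<sigma> = (1 / (\<sigma> - s)) *\<^sub>R (r \<sigma> - r s)" for \<sigma>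
  have "(q \<longlongrightarrow> r') (at s within {-1..0})"
    unfolding q_def by (rule has_vector_derivative_quotient[OF r])
  then have "((\<lambda>\<sigma>. norm (q \<sigma> - r') * norm v) \<longlongrightarrow> 0 * norm v) (at s within {-1..0})"
    by (intro tendsto_intros) (simp add: LIM_zero tendsto_norm_zero)
  then have lim: "((\<lambda>\<sigma>. norm (q \<sigma> - r') * norm v) \<longlongrightarrow> 0) (at s within {-1..0})" by simp
  have l1: "((\<lambda>\<sigma>. (q \<sigma> - r') \<bullet> tail_indicator \<sigma> v) \<longlongrightarrow> 0) (at s within {-1..0})"
  proof (rule Lim_null_comparison[OF _ lim])
    show "\<forall>\<^sub>F \<sigma> in at s within {-1..0}. norm ((q \<sigma> - r') \<bullet> tail_indicator \<sigma> v) \<le> norm (q \<sigma> - r') * norm v"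
      unfolding eventually_at_filter
    proof (intro always_eventually allI impI)
      fix \<sigma> assume "\<sigma> \<in> {-1..0::real}"
      then show "norm ((q \<sigma> - r') \<bullet> tail_indicator \<sigma> v) \<le> norm (q \<sigma> - r') * norm v"
        unfolding real_norm_def
        by (intro order.trans[OF Cauchy_Schwarz_ineq2] mult_left_mono norm_tail_indicator_le) auto
    qed
  qed
  have l2: "((\<lambda>\<sigma>. r' \<bullet> tail_indicator \<sigma> v) \<longlongrightarrow> r' \<bullet> tail_indicator s v) (at s within {-1..0})"
    using continuous_on_inner_tail_indicator[of r' v] s by (simp add: continuous_on_def)
  have l3: "((\<lambda>\<sigma>. (1 / (\<sigma> - s)) *\<^sub>R (r s \<bullet> tail_indicator \<sigma> v - r s \<bullet> tail_indicator s v)) \<longlongrightarrow> d) (at s within {-1..0})"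
    by (rule has_vector_derivative_quotient[OF d])
  have "((\<lambda>\<sigma>. (q \<sigma> - r') \<bullet> tail_indicator \<sigma> v + r' \<bullet> tail_indicator \<sigma> v
      + (1 / (\<sigma> - s)) *\<^sub>R (r s \<bullet> tail_indicator \<sigma> v - r s \<bullet> tail_indicator s v)) \<longlongrightarrow>
      0 + r' \<bullet> tail_indicator s v + d) (at s within {-1..0})"
    by (intro tendsto_add l1 l2 l3)
  also have "(\<lambda>\<sigma>. (q \<sigma> - r') \<bullet> tail_indicator \<sigma> v + r' \<bullet> tail_indicator \<sigma> v
      + (1 / (\<sigma> - s)) *\<^sub>R (r s \<bullet> tail_indicator \<sigma> v - r s \<bullet> tail_indicator s v)) =
      (\<lambda>\<sigma>. (r \<sigma> \<bullet> tail_indicator \<sigma> v - r s \<bullet> tail_indicator s v) / (\<sigma> - s))"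
    by (rule ext) (simp add: q_def inner_diff_left divide_inverse algebra_simps)
  finally show ?thesis
    by (simp only: has_field_derivative_iff has_real_derivative_iff_has_vector_derivative[symmetric] add_0_left)
qed

lemma tail_derivative:
  fixes c :: "real \<Rightarrow> 'a::euclidean_space"
  assumes c: "continuous_on {-1..0} c" and a: "a \<in> {-1..0}"
  shows "((\<lambda>\<sigma>. to_L2 c \<bullet> tail_indicator \<sigma> v) has_vector_derivative - (c a \<bullet> v)) (at a within {-1..0})"
proof -
  have "((\<lambda>u. integral {u..0} c) has_vector_derivative - c a) (at a within {-1..0})"
    by (rule integral_has_vector_derivative'[OF c a])
  then have "((\<lambda>u. integral {u..0} c \<bullet> v) has_vector_derivative (- c a) \<bullet> v) (at a within {-1..0})"
    by (rule bounded_linear.has_vector_derivative[OF bounded_linear_inner_left])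
  then have "((\<lambda>u. integral {u..0} c \<bullet> v) has_vector_derivative - (c a \<bullet> v)) (at a within {-1..0})" by simp
  then show ?thesis
    by (rule has_vector_derivative_transform[OF a, rotated])
      (simp add: inner_tail_indicator[OF square_integrable_continuous[OF c]])
qed

section \<open>Multiplication by the transposed matrix functions\<close>

lemma to_L2_add:
  assumes "square_integrable f" "square_integrable g"
  shows "to_L2 (\<lambda>\<theta>. f \<theta> + g \<theta>) = to_L2 f + to_L2 g"
  unfolding to_L2_def using assms by (simp add: plus_L2.abs_eq L2_eq_refl_iff)

lemma to_L2_scaleR:
  assumes "square_integrable f"
  shows "to_L2 (\<lambda>\<theta>. c *\<^sub>R f \<theta>) = c *\<^sub>R to_L2 f"
  unfolding to_L2_def using assms by (simp add: scaleR_L2.abs_eq L2_eq_refl_iff)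

lemma square_integrable_sum:
  assumes "finite I" "\<And>i. i \<in> I \<Longrightarrow> square_integrable (f i)"
  shows "square_integrable (\<lambda>\<theta>. \<Sum>i\<in>I. f i \<theta>)"
  using assms by (induction I rule: finite_induct) (auto simp: square_integrable_0 square_integrable_add)

lemma square_integrable_scaleR_const:
  fixes f :: "real \<Rightarrow> real" and v :: "'a::euclidean_space"
  assumes "square_integrable f"
  shows "square_integrable (\<lambda>\<theta>. f \<theta> *\<^sub>R v)"
  using assms by (auto simp: square_integrable_def power_mult_distrib)

lemma square_integrable_vec:
  fixes f :: "real \<Rightarrow> real^'n"
  assumes "\<And>i. square_integrable (\<lambda>\<theta>. f \<theta> $ i)"
  shows "square_integrable f"
proof -
  have "square_integrable (\<lambda>\<theta>. \<Sum>i\<in>UNIV. (f \<theta> $ i) *\<^sub>R axis i (1::real))"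
    by (intro square_integrable_sum square_integrable_scaleR_const assms) simp
  moreover have "(\<Sum>i\<in>UNIV. (f \<theta> $ i) *\<^sub>R axis i (1::real)) = f \<theta>" for \<theta>
    using basis_expansion[of "f \<theta>"] by (simp add: scalar_mult_eq_scaleR)
  ultimately show ?thesis by (simp only:)
qed

lemma L2_matrix_mult:
  assumes "L2_matrix A"
  shows "square_integrable (\<lambda>\<theta>. A \<theta> *v v)"
proof (rule square_integrable_vec)
  fix i
  have "square_integrable (\<lambda>\<theta>. \<Sum>j\<in>UNIV. v $ j *\<^sub>R (A \<theta> $ i $ j))"
    using assms by (intro square_integrable_sum square_integrable_scaleR) (auto simp: L2_matrix_def)
  then show "square_integrable (\<lambda>\<theta>. (A \<theta> *v v) $ i)"
    by (simp add: matrix_vector_mult_def mult.commute)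
qed

lemma L2_matrix_transpose: "L2_matrix A \<Longrightarrow> L2_matrix (\<lambda>\<theta>. transpose (A \<theta>))"
  by (simp add: L2_matrix_def transpose_def)

lemma inner_transpose_mult: "(transpose A *v x) \<bullet> y = x \<bullet> (A *v y)" for A :: "real^'n^'m"
  by (simp add: dot_lmul_matrix)

text \<open>On a finite-dimensional domain linearity suffices. Boundedness lets
  \<open>transpose_mult A2 (w t)\<close> be differentiated in the \<open>L2\<close> norm.\<close>

lemma bounded_linear_transpose_mult:
  assumes "L2_matrix A"
  shows "bounded_linear (transpose_mult A)"
proof -
  note sq = L2_matrix_mult[OF L2_matrix_transpose[OF assms]]
  have "linear (transpose_mult A)"
  proof
    show "transpose_mult A (x + y) = transpose_mult A x + transpose_mult A y" for x y
      unfolding transpose_mult_def matrix_vector_right_distrib by (intro to_L2_add sq)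
    show "transpose_mult A (c *\<^sub>R x) = c *\<^sub>R transpose_mult A x" for c x
      unfolding transpose_mult_def matrix_vector_mult_scaleR by (intro to_L2_scaleR sq)
  qed
  then show ?thesis by (simp add: linear_conv_bounded_linear)
qed

text \<open>Moving the matrix onto \<open>v\<close> separates the time-dependent vector
  \<open>x\<close> from the integral, which becomes a fixed function of \<open>a\<close>.\<close>

lemma inner_transpose_mult_tail:
  assumes "L2_matrix A" and a: "a \<in> {-1..0}"
  shows "transpose_mult A x \<bullet> tail_indicator a v = x \<bullet> integral {a..0} (\<lambda>\<theta>. A \<theta> *v v)"
proof -
  note sq = L2_matrix_mult[OF L2_matrix_transpose[OF assms(1)]]
  note int = integrable_on_lebesgue_on[OF integrable_square_integrable]
  have i1: "(\<lambda>\<theta>. transpose (A \<theta>) *v x) integrable_on {a..0}"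
    by (rule integrable_on_subinterval[OF int[OF sq]]) (use a in auto)
  have i2: "(\<lambda>\<theta>. A \<theta> *v v) integrable_on {a..0}"
    by (rule integrable_on_subinterval[OF int[OF L2_matrix_mult[OF assms(1)]]]) (use a in auto)
  have "transpose_mult A x \<bullet> tail_indicator a v = integral {a..0} (\<lambda>\<theta>. transpose (A \<theta>) *v x) \<bullet> v"
    unfolding transpose_mult_def by (rule inner_tail_indicator[OF sq a])
  also have "\<dots> = integral {a..0} ((\<lambda>y. y \<bullet> v) \<circ> (\<lambda>\<theta>. transpose (A \<theta>) *v x))"
    by (rule integral_linear[OF i1 bounded_linear_inner_left, symmetric])
  also have "\<dots> = integral {a..0} ((\<lambda>y. x \<bullet> y) \<circ> (\<lambda>\<theta>. A \<theta> *v v))"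
    unfolding o_def inner_transpose_mult ..
  also have "\<dots> = x \<bullet> integral {a..0} (\<lambda>\<theta>. A \<theta> *v v)"
    by (rule integral_linear[OF i2 bounded_linear_inner_right])
  finally show ?thesis .
qed

section \<open>From the abstract equation to the neutral equation\<close>

lemma abstract_solution_componentsE:
  assumes "abstract_solution (adjoint_domain Am1 A2) (adjoint_op A2 A3) (\<lambda>t. (w t, \<psi> t))"
  obtains w' \<psi>' where "continuous_on {0..} w'"
    "\<And>t. t \<ge> 0 \<Longrightarrow> (w has_vector_derivative w' t) (at t within {0..})"
    "\<And>t. t \<ge> 0 \<Longrightarrow> (\<psi> has_vector_derivative \<psi>' t) (at t within {0..})"
    "\<And>t. t \<ge> 0 \<Longrightarrow> \<psi> t + transpose_mult A2 (w t) \<in> H1"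
    "\<And>t. t \<ge> 0 \<Longrightarrow> L2_at (\<psi> t + transpose_mult A2 (w t)) 0 = w' t"
    "\<And>t. t \<ge> 0 \<Longrightarrow> L2_at (\<psi> t + transpose_mult A2 (w t)) (-1) = transpose Am1 *v w' t"
    "\<And>t. t \<ge> 0 \<Longrightarrow> \<psi>' t = - weak_deriv (\<psi> t + transpose_mult A2 (w t)) + transpose_mult A3 (w t)"
proof -
  obtain x' where c: "continuous_on {0..} x'"
    and x': "\<And>t. t \<ge> 0 \<Longrightarrow> ((\<lambda>t. (w t, \<psi> t)) has_vector_derivative x' t) (at t within {0..})"
      "\<And>t. t \<ge> 0 \<Longrightarrow> (w t, \<psi> t) \<in> adjoint_domain Am1 A2"
      "\<And>t. t \<ge> 0 \<Longrightarrow> x' t = adjoint_op A2 A3 (w t, \<psi> t)"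
    using assms unfolding abstract_solution_def by blast
  show ?thesis
  proof (rule that[of "\<lambda>t. fst (x' t)" "\<lambda>t. snd (x' t)"])
    show "continuous_on {0..} (\<lambda>t. fst (x' t))" by (intro continuous_intros c)
    fix t :: real assume t: "t \<ge> 0"
    show "(w has_vector_derivative fst (x' t)) (at t within {0..})"
      using bounded_linear.has_vector_derivative[OF bounded_linear_fst x'(1)[OF t]] by simp
    show "(\<psi> has_vector_derivative snd (x' t)) (at t within {0..})"
      using bounded_linear.has_vector_derivative[OF bounded_linear_snd x'(1)[OF t]] by simp
  \<comment> \<open>The first component of the equation identifies the value of
    \<open>\<psi> t + transpose_mult A2 (w t)\<close> at 0 with the derivative of \<open>w\<close>;
    the boundary condition of the domain then gives the value at -1.\<close>
  qed (use x'(2,3) in \<open>auto simp: adjoint_domain_def adjoint_op_def Let_def\<close>)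
qed

text \<open>The value at \<open>a\<close> of the continuous representative of \<open>r (T + a)\<close>, which is not controlled, enters
  once through the transport equation and once through the moving limit of integration, and cancels.\<close>

lemma characteristic_derivative:
  fixes w w' :: "real \<Rightarrow> real^'n" and r :: "real \<Rightarrow> (real^'n) L2"
  assumes A: "L2_matrix A2" "L2_matrix A3"
    and T: "T \<ge> 1" and a: "a \<in> {-1..0}"
    and H1: "r (T + a) \<in> H1" "L2_at (r (T + a)) 0 = w' (T + a)"
    and w: "(w has_vector_derivative w' (T + a)) (at (T + a) within {0..})"
    and r: "(r has_vector_derivative - weak_deriv (r (T + a)) + transpose_mult A3 (w (T + a))
        + transpose_mult A2 (w' (T + a))) (at (T + a) within {0..})"
  shows "((\<lambda>a. r (T + a) \<bullet> tail_indicator a v + w (T + a) \<bullet> v) has_vector_derivative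
      w (T + a) \<bullet> integral {a..0} (\<lambda>\<theta>. A3 \<theta> *v v) + w' (T + a) \<bullet> integral {a..0} (\<lambda>\<theta>. A2 \<theta> *v v))
    (at a within {-1..0})"
proof -
  have shift: "((\<lambda>a. f (T + a)) has_vector_derivative D) (at a within {-1..0})"
    if "(f has_vector_derivative D) (at (T + a) within {0..})" for f :: "real \<Rightarrow> 'b::real_normed_vector" and D
  proof -
    \<comment> \<open>\<open>T \<ge> 1\<close> keeps \<open>T + a\<close> nonnegative on the whole
      delay interval.\<close>
    have "(f has_vector_derivative D) (at (T + a) within (\<lambda>a. T + a) ` {-1..0})"
      by (rule has_vector_derivative_within_subset[OF that]) (use T in auto)
    moreover have "((\<lambda>a. T + a) has_vector_derivative 1) (at a within {-1..0})"
      by (auto intro!: derivative_eq_intros)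
    ultimately show ?thesis
      using vector_diff_chain_within[of "\<lambda>a. T + a" 1 a "{-1..0}" f D] by (simp add: o_def)
  qed
  obtain c where c: "continuous_on {-1..0} c" "r (T + a) = to_L2 c"
    "\<And>b. b \<in> {-1..0} \<Longrightarrow> L2_at (r (T + a)) b = c b"
    "\<And>b. b \<in> {-1..0} \<Longrightarrow> integral {b..0} (rep_L2 (weak_deriv (r (T + a)))) = c 0 - c b"
    using H1_primitive[OF H1(1)] by blast
  have c0: "c 0 = w' (T + a)" using c(3)[of 0] H1(2) by simp
  have "((\<lambda>\<sigma>. r (T + a) \<bullet> tail_indicator \<sigma> v) has_vector_derivative - (c a \<bullet> v)) (at a within {-1..0})"
    unfolding c(2) by (rule tail_derivative[OF c(1) a])
  from moving_tail_derivative[of "\<lambda>a. r (T + a)", OF shift[OF r] a this]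
  have "((\<lambda>a. r (T + a) \<bullet> tail_indicator a v) has_vector_derivative
      (- weak_deriv (r (T + a)) + transpose_mult A3 (w (T + a)) + transpose_mult A2 (w' (T + a))) \<bullet> tail_indicator a v
      + - (c a \<bullet> v)) (at a within {-1..0})" .
  moreover have "((\<lambda>a. w (T + a) \<bullet> v) has_vector_derivative w' (T + a) \<bullet> v) (at a within {-1..0})"
    by (rule bounded_linear.has_vector_derivative[OF bounded_linear_inner_left shift[OF w]])
  ultimately have "((\<lambda>a. r (T + a) \<bullet> tail_indicator a v + w (T + a) \<bullet> v) has_vector_derivative
      (- weak_deriv (r (T + a)) + transpose_mult A3 (w (T + a)) + transpose_mult A2 (w' (T + a))) \<bullet> tail_indicator a v
      + - (c a \<bullet> v) + w' (T + a) \<bullet> v) (at a within {-1..0})"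
    by (rule has_vector_derivative_add)
  \<comment> \<open>The weak derivative contributes \<open>- (c 0 - c a) \<bullet> v\<close>. Here
    \<open>c a\<close> cancels against the moving limit, and \<open>c 0 = w' (T + a)\<close> against
    the derivative of the added term \<open>w (T + a) \<bullet> v\<close>.\<close>
  also have "(- weak_deriv (r (T + a)) + transpose_mult A3 (w (T + a)) + transpose_mult A2 (w' (T + a))) \<bullet> tail_indicator a v
      + - (c a \<bullet> v) + w' (T + a) \<bullet> v =
      w (T + a) \<bullet> integral {a..0} (\<lambda>\<theta>. A3 \<theta> *v v) + w' (T + a) \<bullet> integral {a..0} (\<lambda>\<theta>. A2 \<theta> *v v)"
    using inner_tail_indicator_rep[OF a, of "weak_deriv (r (T + a))" v]
    by (simp add: inner_add_left inner_transpose_mult_tail[OF _ a] A c(4)[OF a] c0 inner_diff_left)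
  finally show ?thesis .
qed

theorem theorem2p2:
  fixes Am1 :: "real^'n^'n"
    and A2 A3 :: "real \<Rightarrow> real^'n^'n"
    and w :: "real \<Rightarrow> real^'n"
    and \<psi> :: "real \<Rightarrow> (real^'n) L2"
  assumes "L2_matrix A2" and "L2_matrix A3"
    and "abstract_solution (adjoint_domain Am1 A2) (adjoint_op A2 A3) (\<lambda>t. (w t, \<psi> t))"
  shows "neutral_solution Am1 A2 A3 w"
proof -
  obtain w' \<psi>' where cw': "continuous_on {0..} w'"
    and w: "\<And>t. t \<ge> 0 \<Longrightarrow> (w has_vector_derivative w' t) (at t within {0..})"
    and \<psi>: "\<And>t. t \<ge> 0 \<Longrightarrow> (\<psi> has_vector_derivative \<psi>' t) (at t within {0..})"
    and H1: "\<And>t. t \<ge> 0 \<Longrightarrow> \<psi> t + transpose_mult A2 (w t) \<in> H1"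
    and at0: "\<And>t. t \<ge> 0 \<Longrightarrow> L2_at (\<psi> t + transpose_mult A2 (w t)) 0 = w' t"
    and at1: "\<And>t. t \<ge> 0 \<Longrightarrow> L2_at (\<psi> t + transpose_mult A2 (w t)) (-1) = transpose Am1 *v w' t"
    and \<psi>': "\<And>t. t \<ge> 0 \<Longrightarrow> \<psi>' t = - weak_deriv (\<psi> t + transpose_mult A2 (w t)) + transpose_mult A3 (w t)"
    using abstract_solution_componentsE[OF assms(3)] by blast
  define r where "r t = \<psi> t + transpose_mult A2 (w t)" for t
  define r' where "r' t = - weak_deriv (r t) + transpose_mult A3 (w t) + transpose_mult A2 (w' t)" for t
  have r: "(r has_vector_derivative r' t) (at t within {0..})" if "t \<ge> 0" for t
    using has_vector_derivative_add[OF \<psi>[OF that]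
        bounded_linear.has_vector_derivative[OF bounded_linear_transpose_mult[OF assms(1)] w[OF that]]]
    unfolding r_def r'_def \<psi>'[OF that] .
  have cw: "continuous_on {0..} w"
    using w has_vector_derivative_continuous by (force simp: continuous_on_eq_continuous_within)
  \<comment> \<open>A primitive of \<open>w\<close> gives the \<open>A3\<close> term the same shape
    as the \<open>A2\<close> term, so both are integrated by parts alike. The base point 0 is
    immaterial: only differences of \<open>W\<close> enter.\<close>
  define W where "W t = integral {0..t} w" for t
  have W: "(W has_vector_derivative w t) (at t within {0..})" if t: "t \<ge> 0" for t
  proof -
    have "(W has_vector_derivative w t) (at t within {0..t + 1})"
      unfolding W_def by (rule integral_has_vector_derivative) (use t in \<open>auto intro: continuous_on_subset[OF cw]\<close>)
    \<comment> \<open>The added 1 leaves room to the right of \<open>t\<close>, so the compact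
      interval and the half-line give the same derivative at \<open>t\<close>.\<close>
    moreover have "at t within {0..t + 1} = at t within {0..}"
      by (rule at_within_nhd[of _ "{..<t + 1}"]) auto
    ultimately show ?thesis by simp
  qed
  have shift: "continuous_on {-1..0} (\<lambda>\<tau>. f (t + 1 + \<tau>))" if "continuous_on {0..} f" "t \<ge> 0"
    for f :: "real \<Rightarrow> real^'n" and t
    by (rule continuous_on_compose2[OF that(1)]) (use that in \<open>auto intro!: continuous_intros\<close>)
  have shiftD: "((\<lambda>\<tau>. f (t + 1 + \<tau>)) has_vector_derivative f' (t + 1 + a)) (at a within {-1..0})"
    if "\<And>t. t \<ge> 0 \<Longrightarrow> (f has_vector_derivative f' t) (at t within {0..})" "t \<ge> 0" "a \<in> {-1..0}"
    for f f' :: "real \<Rightarrow> real^'n" and t a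
  proof -
    have "(f has_vector_derivative f' (t + 1 + a)) (at (t + 1 + a) within (\<lambda>a. t + 1 + a) ` {-1..0})"
      by (rule has_vector_derivative_within_subset[OF that(1)]) (use that in auto)
    moreover have "((\<lambda>a. t + 1 + a) has_vector_derivative 1) (at a within {-1..0})"
      by (auto intro!: derivative_eq_intros)
    ultimately show ?thesis
      using vector_diff_chain_within[of "\<lambda>a. t + 1 + a" 1 a "{-1..0}" f] by (simp add: o_def)
  qed
  have i2: "integrable lebI (\<lambda>\<theta>. A2 \<theta> *v v)" and i3: "integrable lebI (\<lambda>\<theta>. A3 \<theta> *v v)" for v
    by (intro integrable_square_integrable L2_matrix_mult assms)+
  have int2: "integrable lebI (\<lambda>\<tau>. w' (t + 1 + \<tau>) \<bullet> (A2 \<tau> *v v))"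
    and int3: "integrable lebI (\<lambda>\<tau>. w (t + 1 + \<tau>) \<bullet> (A3 \<tau> *v v))" if "t \<ge> 0" for t v
    by (intro integrable_lebI_continuous_inner shift cw cw' i2 i3 that)+
  have int: "integrable lebI (\<lambda>\<tau>. transpose (A2 \<tau>) *v w' (t + 1 + \<tau>) + transpose (A3 \<tau>) *v w (t + 1 + \<tau>))"
    if "t \<ge> 0" for t
    by (rule integrable_componentwise_lebI)
      (simp only: inner_add_left inner_transpose_mult Bochner_Integration.integrable_add int2 int3 that)
  \<comment> \<open>Integration by parts trades \<open>w'\<close> for \<open>w\<close> and
    \<open>w\<close> for \<open>W\<close>, so every term on the right is continuously differentiable
    in \<open>t\<close>; the terms with \<open>W t\<close> and \<open>w t\<close> in front of an
    integral are the boundary terms at -1.\<close>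
  have identity: "r t \<bullet> tail_indicator (-1) v = w (t + 1) \<bullet> v - w t \<bullet> v
      - ((\<integral>\<tau>. W (t + 1 + \<tau>) \<bullet> (A3 \<tau> *v v) \<partial>lebI) - W t \<bullet> integral {-1..0} (\<lambda>\<theta>. A3 \<theta> *v v))
      - ((\<integral>\<tau>. w (t + 1 + \<tau>) \<bullet> (A2 \<tau> *v v) \<partial>lebI) - w t \<bullet> integral {-1..0} (\<lambda>\<theta>. A2 \<theta> *v v))"
    if t: "t \<ge> 0" for t v
  proof -
    define B2 where "B2 a = integral {a..0} (\<lambda>\<theta>. A2 \<theta> *v v)" for a
    define B3 where "B3 a = integral {a..0} (\<lambda>\<theta>. A3 \<theta> *v v)" for a
    have cB: "continuous_on {-1..0} B2" "continuous_on {-1..0} B3"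
      unfolding B2_def B3_def
      by (intro indefinite_integral_continuous_1' integrable_on_lebesgue_on i2 i3; simp)+
    \<comment> \<open>The characteristic with \<open>T = t + 1\<close> runs from time
      \<open>t\<close> at \<open>a = -1\<close> to time \<open>t + 1\<close> at
      \<open>a = 0\<close>.\<close>
    have "((\<lambda>a. w (t + 1 + a) \<bullet> B3 a + w' (t + 1 + a) \<bullet> B2 a) has_integral
        (r (t + 1 + 0) \<bullet> tail_indicator 0 v + w (t + 1 + 0) \<bullet> v) -
        (r (t + 1 + -1) \<bullet> tail_indicator (-1) v + w (t + 1 + -1) \<bullet> v)) {-1..0}"
    proof (rule fundamental_theorem_of_calculus)
      fix a :: real assume a: "a \<in> {-1..0}"
      then have ta: "t + 1 + a \<ge> 0" using t by simp
      show "((\<lambda>a. r (t + 1 + a) \<bullet> tail_indicator a v + w (t + 1 + a) \<bullet> v) has_vector_derivative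
          w (t + 1 + a) \<bullet> B3 a + w' (t + 1 + a) \<bullet> B2 a) (at a within {-1..0})"
        unfolding B2_def B3_def
        by (rule characteristic_derivative[OF assms(1,2) _ a])
          (use t r[OF ta] H1[OF ta] at0[OF ta] w[OF ta] in \<open>simp_all add: r_def[symmetric] r'_def\<close>)
    qed simp
    \<comment> \<open>The tail at 0 is a single point, so the unknown state at time
      \<open>t + 1\<close> drops out.\<close>
    moreover have "r (t + 1) \<bullet> tail_indicator 0 v = 0"
      by (simp add: inner_tail_indicator_rep)
    ultimately have "w (t + 1) \<bullet> v - r t \<bullet> tail_indicator (-1) v - w t \<bullet> v =
        integral {-1..0} (\<lambda>a. w (t + 1 + a) \<bullet> B3 a + w' (t + 1 + a) \<bullet> B2 a)"
      by (simp add: integral_unique)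
    also have "\<dots> = integral {-1..0} (\<lambda>a. w (t + 1 + a) \<bullet> B3 a) + integral {-1..0} (\<lambda>a. w' (t + 1 + a) \<bullet> B2 a)"
      by (intro Henstock_Kurzweil_Integration.integral_add integrable_continuous_interval continuous_on_inner
          shift cw cw' t cB)
    also have "integral {-1..0} (\<lambda>a. w (t + 1 + a) \<bullet> B3 a) =
        (\<integral>\<tau>. W (t + 1 + \<tau>) \<bullet> (A3 \<tau> *v v) \<partial>lebI) - W t \<bullet> B3 (-1)"
      using integration_by_parts_tail[OF shiftD[OF W t] shift[OF cw t] i3] by (simp add: B3_def)
    also have "integral {-1..0} (\<lambda>a. w' (t + 1 + a) \<bullet> B2 a) =
        (\<integral>\<tau>. w (t + 1 + \<tau>) \<bullet> (A2 \<tau> *v v) \<partial>lebI) - w t \<bullet> B2 (-1)"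
      using integration_by_parts_tail[OF shiftD[OF w t] shift[OF cw' t] i2] by (simp add: B2_def)
    finally show ?thesis by (simp add: B2_def B3_def)
  qed
  have "w' (t + 1) = transpose Am1 *v w' t +
      (\<integral>\<tau>. (transpose (A2 \<tau>) *v w' (t + 1 + \<tau>) + transpose (A3 \<tau>) *v w (t + 1 + \<tau>)) \<partial>lebI)"
    (is "_ = _ + ?I") if t: "t \<ge> 0" for t
  proof -
    have "w' (t + 1) \<bullet> v = (transpose Am1 *v w' t + ?I) \<bullet> v" for v
    proof -
      define b2 where "b2 = integral {-1..0} (\<lambda>\<theta>. A2 \<theta> *v v)"
      define b3 where "b3 = integral {-1..0} (\<lambda>\<theta>. A3 \<theta> *v v)"
      define J2 where "J2 = (\<integral>\<tau>. w' (t + 1 + \<tau>) \<bullet> (A2 \<tau> *v v) \<partial>lebI)"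
      define J3 where "J3 = (\<integral>\<tau>. w (t + 1 + \<tau>) \<bullet> (A3 \<tau> *v v) \<partial>lebI)"
      have inner: "((\<lambda>s. f s \<bullet> y) has_vector_derivative D \<bullet> y) (at t within S)"
        if "(f has_vector_derivative D) (at t within S)" for f D S and y :: "'b::real_inner"
        by (rule bounded_linear.has_vector_derivative[OF bounded_linear_inner_left that])
      have w1: "((\<lambda>s. w (s + 1)) has_vector_derivative w' (t + 1)) (at t within {0..})"
      proof -
        have "(w has_vector_derivative w' (t + 1)) (at (t + 1) within (\<lambda>s. s + 1) ` {0..})"
          by (rule has_vector_derivative_within_subset[OF w]) (use t in auto)
        moreover have "((\<lambda>s. s + 1) has_vector_derivative 1) (at t within {0..})"
          by (auto intro!: derivative_eq_intros)
        ultimately show ?thesis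
          using vector_diff_chain_within[of "\<lambda>s. s + 1" 1 t "{0..}" w] by (simp add: o_def)
      qed
      have D1: "((\<lambda>s. r s \<bullet> tail_indicator (-1) v) has_vector_derivative r' t \<bullet> tail_indicator (-1) v) (at t within {0..})"
        by (rule inner[OF r[OF t]])
      \<comment> \<open>Differentiating under the delay integrals turns \<open>W\<close> and
        \<open>w\<close> back into \<open>w\<close> and \<open>w'\<close>.\<close>
      have "((\<lambda>s. w (s + 1) \<bullet> v - w s \<bullet> v
          - ((\<integral>\<tau>. W (s + 1 + \<tau>) \<bullet> (A3 \<tau> *v v) \<partial>lebI) - W s \<bullet> b3)
          - ((\<integral>\<tau>. w (s + 1 + \<tau>) \<bullet> (A2 \<tau> *v v) \<partial>lebI) - w s \<bullet> b2)) has_vector_derivative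
          w' (t + 1) \<bullet> v - w' t \<bullet> v - (J3 - w t \<bullet> b3) - (J2 - w' t \<bullet> b2)) (at t within {0..})"
        unfolding J2_def J3_def
        by (intro has_vector_derivative_diff inner w1 w W leibniz_delay[OF W cw i3 t] leibniz_delay[OF w cw' i2 t] t)
      then have D2: "((\<lambda>s. r s \<bullet> tail_indicator (-1) v) has_vector_derivative
          w' (t + 1) \<bullet> v - w' t \<bullet> v - (J3 - w t \<bullet> b3) - (J2 - w' t \<bullet> b2)) (at t within {0..})"
        by (rule has_vector_derivative_transform[rotated 2]) (use t in \<open>simp_all add: identity b2_def b3_def\<close>)
      \<comment> \<open>The transport equation and the integrated identity give two derivatives of
        the same function. They are compared on the nondegenerate interval from \<open>t\<close> to
        \<open>t + 1\<close>, where one-sided derivatives are unique, also at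
        \<open>t = 0\<close>.\<close>
      have "r' t \<bullet> tail_indicator (-1) v = w' (t + 1) \<bullet> v - w' t \<bullet> v - (J3 - w t \<bullet> b3) - (J2 - w' t \<bullet> b2)"
      proof (rule vector_derivative_unique_within_closed_interval[of t "t + 1" t "\<lambda>s. r s \<bullet> tail_indicator (-1) v"])
        show "((\<lambda>s. r s \<bullet> tail_indicator (-1) v) has_vector_derivative r' t \<bullet> tail_indicator (-1) v) (at t within cbox t (t + 1))"
          by (rule has_vector_derivative_within_subset[OF D1]) (use t in auto)
        show "((\<lambda>s. r s \<bullet> tail_indicator (-1) v) has_vector_derivative
            w' (t + 1) \<bullet> v - w' t \<bullet> v - (J3 - w t \<bullet> b3) - (J2 - w' t \<bullet> b2)) (at t within cbox t (t + 1))"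
          by (rule has_vector_derivative_within_subset[OF D2]) (use t in auto)
      qed simp_all
      moreover have "r' t \<bullet> tail_indicator (-1) v = - (w' t - transpose Am1 *v w' t) \<bullet> v + w t \<bullet> b3 + w' t \<bullet> b2"
      proof -
        have rH: "r t \<in> H1" using H1[OF t] by (simp add: r_def)
        obtain c where "continuous_on {-1..0} c" "r t = to_L2 c" and c: "\<And>a. a \<in> {-1..0} \<Longrightarrow> L2_at (r t) a = c a"
          "\<And>a. a \<in> {-1..0} \<Longrightarrow> integral {a..0} (rep_L2 (weak_deriv (r t))) = c 0 - c a"
          using H1_primitive[OF rH] by blast
        \<comment> \<open>The whole-interval integral of the weak derivative is the difference of
          the two boundary values; this is where the boundary condition and thus \<open>Am1\<close>
          enter.\<close>
        have "integral {-1..0} (rep_L2 (weak_deriv (r t))) = w' t - transpose Am1 *v w' t"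
          using c(1)[of 0] c(1)[of "-1"] c(2)[of "-1"] at0[OF t] at1[OF t] by (simp add: r_def)
        then have "weak_deriv (r t) \<bullet> tail_indicator (-1) v = (w' t - transpose Am1 *v w' t) \<bullet> v"
          using inner_tail_indicator_rep[of "-1" "weak_deriv (r t)" v] by simp
        then show ?thesis
          unfolding r'_def inner_add_left inner_minus_left b2_def b3_def
          by (simp add: inner_transpose_mult_tail assms)
      qed
      moreover have "?I \<bullet> v = J2 + J3"
      proof -
        have "?I \<bullet> v = (\<integral>\<tau>. (transpose (A2 \<tau>) *v w' (t + 1 + \<tau>) + transpose (A3 \<tau>) *v w (t + 1 + \<tau>)) \<bullet> v \<partial>lebI)"
          using int[OF t] by (intro integral_inner_left[symmetric])
        also have "\<dots> = (\<integral>\<tau>. w' (t + 1 + \<tau>) \<bullet> (A2 \<tau> *v v) + w (t + 1 + \<tau>) \<bullet> (A3 \<tau> *v v) \<partial>lebI)"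
          by (simp only: inner_add_left inner_transpose_mult)
        also have "\<dots> = J2 + J3"
          unfolding J2_def J3_def by (intro Bochner_Integration.integral_add int2 int3 t)
        finally show ?thesis .
      qed
      \<comment> \<open>The terms \<open>w' t \<bullet> v\<close>, \<open>w t \<bullet> b3\<close>
        and \<open>w' t \<bullet> b2\<close> occur in both expressions for the derivative and
        cancel.\<close>
      ultimately show ?thesis
        by (simp only: inner_add_left inner_diff_left inner_minus_left)
    qed
    then show ?thesis using vector_eq_rdot[of "w' (t + 1)" "transpose Am1 *v w' t + ?I"] by blast
  qed
  then show ?thesis
    unfolding neutral_solution_def using cw' w int by blast
qed

end
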